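(* Let $X$ be a polygonal $\mathbb{Z}^2$-shift with a coding polygon having no pair of antiparallel sides. Then the entropy seminorm $\|\cdot\|_X$ on $\mathbb{R}^2$ is either trivial (identically zero) or a norm.
   Context: For a finite alphabet $\mathcal{A}$ (discrete topology), a $\mathbb{Z}^2$-shift is a closed subset $X\subset\mathcal{A}^{\mathbb{Z}^2}$ (product topology) invariant under the shifts $(T^ux)(v)=x(u+v)$, $u\in\mathbb{Z}^2$. For $A,B\subset\mathbb{R}^2$, $A$ $X$-codes $B$ if whenever $x,x'\in X$ agree on $A\cap\mathbb{Z}^2$ they agree on $B\cap\mathbb{Z}^2$. An integer polygon is a polygon in $\mathbb{R}^2$ (including its interior) with all vertices in $\mathbb{Z}^2$. A convex integer polygon $\mathcal{P}$ is a coding polygon for an infinite $\mathbb{Z}^2$-shift $X$ if for every vertex $v$ of $\mathcal{P}$, $\mathcal{P}\setminus\{v\}$ $X$-codes $\{v\}$. $X$ is polygonal if it is infinite and has a coding polygon. The sides carry the counterclockwise boundary orientation; two sides of a convex polygon are antiparallel if they are parallel with opposite orientations (for a convex polygon, this just means two distinct sides are parallel). For $\mathcal{S}\subset\mathbb{R}^2$ let $P(X,\mathcal{S})$ be the number of distinct restrictions of elements of $X$ to $\mathcal{S}\cap\mathbb{Z}^2$. For a (possibly degenerate) polygon $\mathcal{P}\subset\mathbb{R}^2$ and $r>0$ let $\mathcal{P}_r=\{u\in\mathbb{Z}^2: d(u,\mathcal{P})<r\}$, with $d$ Euclidean distance, and $$\mathcal{H}(X,\mathcal{P})=\lim_{r\to\infty}\lim_{n\to\infty}\frac{\ln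 P(X,(n\mathcal{P})_r)}{n}.$$ For $v\in\mathbb{R}^2$ let $I_v=\{tv: t\in[0,1]\}$. The directional entropy is $h_v(X)=\mathcal{H}(X,I_v)$, and the entropy seminorm of $X$ is $\|v\|_X=h_v(X)$. *)

theory Defs
  imports "HOL-Analysis.Analysis"
begin

type_synonym 'a config = "int \<times> int \<Rightarrow> 'a"

definition lattice_pt :: "int \<times> int \<Rightarrow> real \<times> real" where
  "lattice_pt u = (of_int (fst u), of_int (snd u))"

definition translate :: "int \<times> int \<Rightarrow> 'a config \<Rightarrow> 'a config" where
  "translate u x = (\<lambda>v. x (u + v))"

definition Z2_shift :: "'a set \<Rightarrow> 'a config set \<Rightarrow> bool" where
  "Z2_shift A X \<longleftrightarrow>
     finite A \<and>
     closedin (product_topology (\<lambda>_. discrete_topology A) UNIV) X \<and>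
     (\<forall>u. translate u ` X \<subseteq> X)"

definition agree_on :: "(real \<times> real) set \<Rightarrow> 'a config \<Rightarrow> 'a config \<Rightarrow> bool" where
  "agree_on S x x' \<longleftrightarrow> (\<forall>u. lattice_pt u \<in> S \<longrightarrow> x u = x' u)"

definition codes :: "'a config set \<Rightarrow> (real \<times> real) set \<Rightarrow> (real \<times> real) set \<Rightarrow> bool" where
  "codes X S T \<longleftrightarrow> (\<forall>x\<in>X. \<forall>x'\<in>X. agree_on S x x' \<longrightarrow> agree_on T x x')"

text \<open>Polygons are taken to be non-degenerate, that is, to have non-empty interior. The vertices
  of a convex polygon are its extreme points, and its sides are its one-dimensional faces.\<close>

definition convex_integer_polygon :: "(real \<times> real) set \<Rightarrow> bool" where
  "convex_integer_polygon P \<longleftrightarrow>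
     polytope P \<and> interior P \<noteq> {} \<and> {v. v extreme_point_of P} \<subseteq> range lattice_pt"

definition coding_polygon :: "'a config set \<Rightarrow> (real \<times> real) set \<Rightarrow> bool" where
  "coding_polygon X P \<longleftrightarrow>
     infinite X \<and> convex_integer_polygon P \<and>
     (\<forall>v. v extreme_point_of P \<longrightarrow> codes X (P - {v}) {v})"

definition polygonal :: "'a set \<Rightarrow> 'a config set \<Rightarrow> bool" where
  "polygonal A X \<longleftrightarrow> Z2_shift A X \<and> infinite X \<and> (\<exists>P. coding_polygon X P)"

definition cross :: "real \<times> real \<Rightarrow> real \<times> real \<Rightarrow> real" where
  "cross a b = fst a * snd b - snd a * fst b"

text \<open>The side from \<open>p\<close> to \<open>q\<close> is directed counterclockwise when \<open>P\<close> lies to its left.\<close>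

definition oriented_side :: "(real \<times> real) set \<Rightarrow> real \<times> real \<Rightarrow> real \<times> real \<Rightarrow> bool" where
  "oriented_side P p q \<longleftrightarrow>
     closed_segment p q edge_of P \<and> (\<forall>z\<in>P. cross (q - p) (z - p) \<ge> 0)"

definition has_antiparallel_sides :: "(real \<times> real) set \<Rightarrow> bool" where
  "has_antiparallel_sides P \<longleftrightarrow>
     (\<exists>p q p' q'. oriented_side P p q \<and> oriented_side P p' q' \<and>
        (\<exists>c<0. q' - p' = c *\<^sub>R (q - p)))"

definition pattern_count :: "'a config set \<Rightarrow> (real \<times> real) set \<Rightarrow> nat" where
  "pattern_count X S = card ((\<lambda>x. restrict x {u. lattice_pt u \<in> S}) ` X)"

definition lattice_nbhd :: "(real \<times> real) set \<Rightarrow> real \<Rightarrow> (real \<times> real) set" where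
  "lattice_nbhd P r = lattice_pt ` {u. infdist (lattice_pt u) P < r}"

text \<open>Both limits are limits of real numbers: if one of them fails to exist or is infinite, the
  value is unspecified.\<close>

definition polygon_entropy :: "'a config set \<Rightarrow> (real \<times> real) set \<Rightarrow> real" where
  "polygon_entropy X P =
     Lim at_top (\<lambda>r::real.
       lim (\<lambda>n::nat. ln (real (pattern_count X (lattice_nbhd ((*\<^sub>R) (real n) ` P) r))) / real n))"

definition directional_entropy :: "'a config set \<Rightarrow> real \<times> real \<Rightarrow> real" where
  "directional_entropy X v = polygon_entropy X {t *\<^sub>R v | t. t \<in> {0..1}}"

abbreviation entropy_seminorm :: "'a config set \<Rightarrow> real \<times> real \<Rightarrow> real" where
  "entropy_seminorm X \<equiv> directional_entropy X"

definition is_norm :: "('v::real_vector \<Rightarrow> real) \<Rightarrow> bool" where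
  "is_norm N \<longleftrightarrow>
     (\<forall>v. N v \<ge> 0) \<and> (\<forall>v. N v = 0 \<longleftrightarrow> v = 0) \<and>
     (\<forall>c v. N (c *\<^sub>R v) = \<bar>c\<bar> * N v) \<and>
     (\<forall>v w. N (v + w) \<le> N v + N w)"

end

theory Submission imports Defs begin

text \<open>
  Write \<open>c(v, r)\<close> for the logarithm of the number of patterns on the \<open>r\<close>-neighbourhood of the segment
  from \<open>0\<close> to \<open>v\<close>, and \<open>h v\<close> for the directional entropy, the growth rate of \<open>c(t v, r)\<close> in \<open>t\<close>.

  A vertex \<open>p\<close> of the coding polygon gives a local rule: the symbol at any site \<open>u\<close> is determined by
  the symbols on \<open>u + F\<close>, where \<open>F\<close> is the polygon without \<open>p\<close>, seen from \<open>p\<close>. If \<open>v\<close> is a direction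
  with \<open>F\<close> strictly to its right (\<open>corner_cone\<close>), then the rule fills in sites on the left of a strip
  in direction \<open>v\<close>. If the reverse of a counterclockwise side of a triangle lies in the cone, then no
  displacement in \<open>F\<close> leaves the triangle across that side. So the lattice points of a triangle are
  determined by a neighbourhood of its other sides, with a radius that does not depend on the size of
  the triangle (\<open>triangle_coded_by_sides\<close>). Two kinds of triangles matter.

  \<^item> A thin triangle over the base \<open>v\<close>. The base determines the triangle, hence a thickening of a
    slightly shorter segment, and also a segment in a second direction \<open>d\<close>. The first fact makes the
    growth rate of \<open>c(t v, r)\<close> independent of the radius; a Fekete argument (\<open>linear_growth_rate\<close>) then
    shows that the limits defining the entropy exist. The second gives \<open>h d \<le> h v\<close>.
  \<^item> The triangle with vertices \<open>0\<close>, \<open>v\<close>, \<open>v + w\<close> for \<open>v\<close> and \<open>w\<close> in the same cone. The path \<open>v\<close>, \<open>w\<close>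
    determines the third side, so \<open>h (v + w) \<le> h v + h w\<close>.

  Without antiparallel sides, in every direction the polygon has a single leftmost or a single
  rightmost point, so the open cones and their negatives cover all nonzero vectors. Hence \<open>h\<close> is an even,
  positively homogeneous function that is convex near every nonzero vector, and along lines avoiding the
  origin local convexity implies convexity; this is the triangle inequality. Finally, if \<open>h v = 0\<close> for
  some \<open>v \<noteq> 0\<close>, then \<open>h d = 0\<close> for a second direction \<open>d\<close>, and the seminorm \<open>h\<close> vanishes identically.
\<close>

section \<open>Lattice points and their neighbourhoods\<close>

lemma inj_lattice_pt: "inj lattice_pt"
  by (auto simp: inj_on_def lattice_pt_def prod_eq_iff)

lemma lattice_pt_add: "lattice_pt (u + v) = lattice_pt u + lattice_pt v"
  by (simp add: lattice_pt_def)

lemma lattice_pt_diff: "lattice_pt (u - v) = lattice_pt u - lattice_pt v"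
  by (simp add: lattice_pt_def)

lemma finite_lattice_points:
  assumes "bounded S"
  shows "finite {u. lattice_pt u \<in> S}"
proof -
  obtain b where b: "\<And>z. z \<in> S \<Longrightarrow> norm z \<le> b"
    using assms bounded_iff by blast
  have "{u. lattice_pt u \<in> S} \<subseteq> {-\<lceil>b\<rceil>..\<lceil>b\<rceil>} \<times> {-\<lceil>b\<rceil>..\<lceil>b\<rceil>}"
  proof
    fix u assume "u \<in> {u. lattice_pt u \<in> S}"
    then have n: "norm (lattice_pt u) \<le> b" using b by blast
    have "\<bar>of_int (fst u)\<bar> \<le> b" "\<bar>of_int (snd u)\<bar> \<le> b"
      using n norm_fst_le[of "of_int (fst u) :: real" "of_int (snd u) :: real"]
        norm_snd_le[of "of_int (snd u) :: real" "of_int (fst u) :: real"]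
      by (auto simp: lattice_pt_def)
    then show "u \<in> {-\<lceil>b\<rceil>..\<lceil>b\<rceil>} \<times> {-\<lceil>b\<rceil>..\<lceil>b\<rceil>}"
      by (auto simp: mem_Times_iff abs_le_iff) linarith+
  qed
  then show ?thesis by (rule finite_subset) simp
qed

text \<open>Rounding a real translation to an integer one moves every point by at most 1. This is the only
  price for translating by arbitrary vectors, and it is paid by enlarging the radius of a
  neighbourhood by 1.\<close>

lemma lattice_pt_near:
  obtains u where "dist z (lattice_pt u) \<le> 1"
proof
  have "\<bar>a - of_int (round a)\<bar> \<le> 1/2" for a :: real
    using of_int_round_abs_le[of a] by (simp add: abs_minus_commute)
  then have *: "norm (fst z - of_int (round (fst z))) \<le> 1/2" 
     "norm (snd z - of_int (round (snd z))) \<le> 1/2"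
    by simp_all
  have "dist z (lattice_pt (round (fst z), round (snd z)))
      = norm (fst z - of_int (round (fst z)), snd z - of_int (round (snd z)))"
    by (simp add: dist_norm lattice_pt_def minus_prod_def)
  also have "\<dots> \<le> 1"
    using norm_Pair_le[of "fst z - of_int (round (fst z))" "snd z - of_int (round (snd z))"] *
    by linarith
  finally show "dist z (lattice_pt (round (fst z), round (snd z))) \<le> 1" .
qed

lemma infdist_less_iff:
  assumes "S \<noteq> {}"
  shows "infdist x S < r \<longleftrightarrow> (\<exists>s\<in>S. dist x s < r)"
  using assms by (subst infdist_notempty) (auto simp: cInf_less_iff bdd_belowI[where m=0])

lemma mem_lattice_nbhd:
  assumes "S \<noteq> {}"
  shows "lattice_pt u \<in> lattice_nbhd S r \<longleftrightarrow> (\<exists>s\<in>S. dist (lattice_pt u) s < r)"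
  using infdist_less_iff[OF assms] inj_lattice_pt by (auto simp: lattice_nbhd_def inj_image_mem_iff)

lemma bounded_lattice_nbhd:
  assumes "bounded S" "S \<noteq> {}"
  shows "bounded (lattice_nbhd S r)"
proof -
  obtain b where b: "\<And>z. z \<in> S \<Longrightarrow> norm z \<le> b"
    using assms bounded_iff by blast
  have "norm z \<le> b + r" if z: "z \<in> lattice_nbhd S r" for z
  proof -
    obtain u where "z = lattice_pt u" using z by (auto simp: lattice_nbhd_def)
    with z obtain s where s: "s \<in> S" "dist z s < r"
      using mem_lattice_nbhd[OF assms(2)] by blast
    have "norm z \<le> norm s + dist z s"
      by (metis dist_norm norm_triangle_sub)
    with s b[OF s(1)] show ?thesis by simp
  qed
  then show ?thesis using bounded_iff by blast
qed

section \<open>Counting the patterns of a shift\<close>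

locale nonempty_Z2_shift =
  fixes A :: "'a set" and X :: "'a config set"
  assumes shift: "Z2_shift A X" and nonempty: "X \<noteq> {}"
begin

lemma translate_mem: "x \<in> X \<Longrightarrow> translate u x \<in> X"
  using shift unfolding Z2_shift_def by blast

lemma finite_patterns:
  assumes "bounded S"
  shows "finite ((\<lambda>x. restrict x {u. lattice_pt u \<in> S}) ` X)"
proof (rule finite_subset)
  have "X \<subseteq> (UNIV \<rightarrow>\<^sub>E A)"
    using shift closedin_subset[of "product_topology (\<lambda>_. discrete_topology A) UNIV" X]
    by (simp add: Z2_shift_def)
  then show "(\<lambda>x. restrict x {u. lattice_pt u \<in> S}) ` X \<subseteq> ({u. lattice_pt u \<in> S} \<rightarrow>\<^sub>E A)"
    by (auto simp: PiE_iff extensional_def subset_iff)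
  show "finite ({u. lattice_pt u \<in> S} \<rightarrow>\<^sub>E A)"
    using shift by (intro finite_PiE finite_lattice_points assms) (simp add: Z2_shift_def)
qed

lemma pattern_count_pos: "bounded S \<Longrightarrow> pattern_count X S \<ge> 1"
  using finite_patterns[of S] nonempty
  by (simp add: pattern_count_def Suc_le_eq card_gt_0_iff)

text \<open>Coding is a surjection from patterns on \<open>S\<close> onto patterns on \<open>T\<close>; this turns every coding statement
  into an estimate of entropy. Monotonicity is the case where \<open>T\<close> lies in \<open>S\<close>.\<close>

lemma pattern_count_le_of_codes:
  assumes "codes X S T" "bounded S"
  shows "pattern_count X T \<le> pattern_count X S"
proof -
  let ?R = "\<lambda>S x. restrict x {u. lattice_pt u \<in> S}"
  have "?R T ` X \<subseteq> (\<lambda>\<phi>. ?R T (inv_into X (?R S) \<phi>)) ` (?R S ` X)"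
  proof
    fix \<phi> assume "\<phi> \<in> ?R T ` X"
    then obtain x where x: "x \<in> X" "\<phi> = ?R T x" by blast
    define y where "y = inv_into X (?R S) (?R S x)"
    have "?R S x \<in> ?R S ` X" using x(1) by blast
    from inv_into_into[OF this] f_inv_into_f[OF this]
    have y: "y \<in> X" "?R S y = ?R S x" unfolding y_def by simp_all
    have "agree_on S y x"
      using y(2) by (auto simp: agree_on_def fun_eq_iff restrict_def split: if_splits)
    then have "agree_on T y x"
      using assms(1) x y by (auto simp: codes_def)
    then have "?R T y = \<phi>"
      unfolding x by (auto simp: agree_on_def fun_eq_iff)
    then show "\<phi> \<in> (\<lambda>\<phi>. ?R T (inv_into X (?R S) \<phi>)) ` (?R S ` X)"
      using x(1) unfolding y_def by blast
  qed
  then show ?thesis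
    unfolding pattern_count_def by (rule surj_card_le[OF finite_patterns[OF assms(2)]])
qed

lemma pattern_count_mono:
  assumes "\<And>u. lattice_pt u \<in> S \<Longrightarrow> lattice_pt u \<in> T" "bounded T"
  shows "pattern_count X S \<le> pattern_count X T"
  using assms by (intro pattern_count_le_of_codes) (auto simp: codes_def agree_on_def)

lemma pattern_count_Un:
  assumes "bounded S" "bounded T"
  shows "pattern_count X (S \<union> T) \<le> pattern_count X S * pattern_count X T"
proof -
  let ?R = "\<lambda>S x. restrict x {u. lattice_pt u \<in> S}"
  have "?R (S \<union> T) ` X
      \<subseteq> (\<lambda>(\<phi>, \<psi>). \<lambda>u. if lattice_pt u \<in> S then \<phi> u else \<psi> u) ` (?R S ` X \<times> ?R T ` X)"
  proof
    fix \<phi> assume "\<phi> \<in> ?R (S \<union> T) ` X"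
    then obtain x where x: "x \<in> X" "\<phi> = ?R (S \<union> T) x" by blast
    have "\<phi> = (\<lambda>(\<phi>, \<psi>). \<lambda>u. if lattice_pt u \<in> S then \<phi> u else \<psi> u) (?R S x, ?R T x)"
      unfolding x by (auto simp: fun_eq_iff)
    with x(1) show "\<phi> \<in> (\<lambda>(\<phi>, \<psi>). \<lambda>u. if lattice_pt u \<in> S then \<phi> u else \<psi> u) ` (?R S ` X \<times> ?R T ` X)"
      by blast
  qed
  then have "pattern_count X (S \<union> T) \<le> card (?R S ` X \<times> ?R T ` X)"
    unfolding pattern_count_def
    by (rule surj_card_le[rotated]) (simp add: finite_patterns assms)
  then show ?thesis by (simp add: card_cartesian_product pattern_count_def)
qed

lemma pattern_count_translate:
  assumes "\<And>v. lattice_pt v \<in> S \<Longrightarrow> lattice_pt (v - u) \<in> T" "bounded T"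
  shows "pattern_count X S \<le> pattern_count X T"
proof -
  let ?R = "\<lambda>S x. restrict x {u. lattice_pt u \<in> S}"
  have "?R S ` X \<subseteq> (\<lambda>\<phi>. restrict (\<lambda>v. \<phi> (v - u)) {v. lattice_pt v \<in> S}) ` (?R T ` X)"
  proof
    fix \<phi> assume "\<phi> \<in> ?R S ` X"
    then obtain x where x: "x \<in> X" "\<phi> = ?R S x" by blast
    have "\<phi> = restrict (\<lambda>v. ?R T (translate u x) (v - u)) {v. lattice_pt v \<in> S}"
      unfolding x using assms by (auto simp: translate_def fun_eq_iff)
    then show "\<phi> \<in> (\<lambda>\<phi>. restrict (\<lambda>v. \<phi> (v - u)) {v. lattice_pt v \<in> S}) ` (?R T ` X)"
      using translate_mem[OF x(1), of u] by blast
  qed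
  then show ?thesis
    unfolding pattern_count_def by (rule surj_card_le[OF finite_patterns[OF assms(2)]])
qed

text \<open>The quantity whose linear growth along a segment is the directional entropy. It is monotone,
  subadditive under unions, and translation invariant up to the loss of 1 in the radius.\<close>

definition log_count :: "(real \<times> real) set \<Rightarrow> real \<Rightarrow> real" where
  "log_count S r = ln (real (pattern_count X (lattice_nbhd S r)))"

lemma log_count_le:
  assumes "\<And>u. lattice_pt u \<in> lattice_nbhd S r \<Longrightarrow> lattice_pt u \<in> T" 
    "bounded S" "S \<noteq> {}" "bounded T"
  shows "log_count S r \<le> ln (real (pattern_count X T))"
  unfolding log_count_def
  using pattern_count_mono[of "lattice_nbhd S r" T] assms
    pattern_count_pos[OF bounded_lattice_nbhd[of S r]]
  by (subst ln_le_cancel_iff) (auto simp: Suc_le_eq intro: le_less_trans)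

lemma log_count_nonneg: "bounded S \<Longrightarrow> S \<noteq> {} \<Longrightarrow> log_count S r \<ge> 0"
  using pattern_count_pos[OF bounded_lattice_nbhd[of S r]]
  by (simp add: log_count_def)

lemma log_count_mono:
  assumes "S \<subseteq> T" "r \<le> r'" "S \<noteq> {}" "bounded T"
  shows "log_count S r \<le> log_count T r'"
  unfolding log_count_def[of T]
proof (rule log_count_le)
  fix u assume "lattice_pt u \<in> lattice_nbhd S r"
  then show "lattice_pt u \<in> lattice_nbhd T r'"
    using assms by (subst mem_lattice_nbhd) (auto simp: mem_lattice_nbhd intro: less_le_trans)
qed (use assms bounded_subset bounded_lattice_nbhd[of T r'] in auto)

lemma log_count_Un:
  assumes "bounded S" "S \<noteq> {}" "bounded T" "T \<noteq> {}"
  shows "log_count (S \<union> T) r \<le> log_count S r + log_count T r"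
proof -
  let ?S = "lattice_nbhd S r" and ?T = "lattice_nbhd T r"
  have b: "bounded ?S" "bounded ?T" using assms bounded_lattice_nbhd by auto
  have "log_count (S \<union> T) r \<le> ln (real (pattern_count X (?S \<union> ?T)))"
    using assms b by (intro log_count_le) (auto simp: mem_lattice_nbhd)
  also have "\<dots> \<le> ln (real (pattern_count X ?S * pattern_count X ?T))"
    using pattern_count_Un[OF b] pattern_count_pos[of "?S \<union> ?T"] b pattern_count_pos[OF b(1)] pattern_count_pos[OF b(2)]
    by (subst ln_le_cancel_iff) (auto simp: Suc_le_eq simp del: of_nat_mult intro: le_less_trans)
  also have "\<dots> = log_count S r + log_count T r"
    using pattern_count_pos[OF b(1)] pattern_count_pos[OF b(2)]
    by (simp add: log_count_def ln_mult_pos)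
  finally show ?thesis .
qed

lemma log_count_translate:
  assumes "bounded S" "S \<noteq> {}"
  shows "log_count ((+) z ` S) r \<le> log_count S (r + 1)"
proof -
  obtain u where u: "dist z (lattice_pt u) \<le> 1" using lattice_pt_near .
  have b: "bounded (lattice_nbhd ((+) z ` S) r)" "bounded (lattice_nbhd S (r + 1))"
    using assms by (auto intro!: bounded_lattice_nbhd bounded_translation)
  have "pattern_count X (lattice_nbhd ((+) z ` S) r) \<le> pattern_count X (lattice_nbhd S (r + 1))"
  proof (rule pattern_count_translate[OF _ b(2)])
    fix v assume "lattice_pt v \<in> lattice_nbhd ((+) z ` S) r"
    then obtain s where s: "s \<in> S" "dist (lattice_pt v) (z + s) < r"
      using assms by (auto simp: mem_lattice_nbhd)
    have "dist (lattice_pt (v - u)) s = norm (lattice_pt v - (z + s) + (z - lattice_pt u))"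
      by (simp add: dist_norm lattice_pt_diff algebra_simps)
    also have "\<dots> \<le> dist (lattice_pt v) (z + s) + dist z (lattice_pt u)"
      unfolding dist_norm by (rule norm_triangle_ineq)
    also have "\<dots> < r + 1" using s u by linarith
    finally show "lattice_pt (v - u) \<in> lattice_nbhd S (r + 1)"
      using s assms by (auto simp: mem_lattice_nbhd)
  qed
  then show ?thesis
    using pattern_count_pos[OF b(1)] unfolding log_count_def
    by (subst ln_le_cancel_iff) (auto simp: Suc_le_eq intro: le_less_trans)
qed

end

section \<open>The cross product and triangles\<close>

lemma cross_simps:
  "cross (a + b) z = cross a z + cross b z" "cross (a - b) z = cross a z - cross b z"
  "cross (- a) z = - cross a z" "cross (c *\<^sub>R a) z = c * cross a z"
  "cross z (a + b) = cross z a + cross z b" "cross z (a - b) = cross z a - cross z b"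
  "cross z (- a) = - cross z a" "cross z (c *\<^sub>R a) = c * cross z a"
  "cross 0 z = 0" "cross z 0 = 0" "cross z z = 0"
  by (simp_all add: cross_def algebra_simps)

lemma cross_swap: "cross w v = - cross v w"
  by (simp add: cross_def)

lemma linear_combination_cross:
  "cross v w *\<^sub>R z = cross z w *\<^sub>R v + cross v z *\<^sub>R w"
  by (simp add: cross_def prod_eq_iff algebra_simps)

text \<open>Moving linearly out of an orthant, look at the first moment when a coordinate reaches zero; the
  time is the least of the ratios \<open>a i / (- b i)\<close> over the decreasing coordinates.\<close>

lemma first_exit:
  fixes a b :: "'i \<Rightarrow> real"
  assumes "finite I" and nonneg: "\<And>i. i \<in> I \<Longrightarrow> a i \<ge> 0" and j: "j \<in> I" "a j + b j < 0"
  obtains s i where "0 \<le> s" "s \<le> 1" "\<And>i. i \<in> I \<Longrightarrow> a i + s * b i \<ge> 0"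
    "i \<in> I" "b i < 0" "a i + s * b i = 0"
proof -
  define J where "J = {i \<in> I. b i < 0}"
  define i where "i = arg_min_on (\<lambda>i. a i / (- b i)) J"
  have "b j < 0" using nonneg[OF j(1)] j(2) by linarith
  then have jJ: "j \<in> J" using j by (simp add: J_def)
  have fin: "finite J" using assms by (simp add: J_def)
  then have i: "i \<in> J" and min: "\<And>k. k \<in> J \<Longrightarrow> a i / (- b i) \<le> a k / (- b k)"
    unfolding i_def using jJ arg_min_if_finite[of J "\<lambda>i. a i / (- b i)"]
    by (auto simp: not_less simp del: minus_divide_right) 
  let ?s = "a i / (- b i)"
  have bi: "b i < 0" "i \<in> I" using i by (auto simp: J_def)
  show thesis
  proof
    show "0 \<le> ?s" using nonneg[OF bi(2)] bi by (simp add: divide_nonneg_neg)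
    have "a j / (- b j) \<le> 1" using j \<open>b j < 0\<close> by (simp add: field_simps)
    with min[OF jJ] show "?s \<le> 1" by linarith
    show "a k + ?s * b k \<ge> 0" if k: "k \<in> I" for k
    proof (cases "b k < 0")
      case True
      then have "?s * (- b k) \<le> a k / (- b k) * (- b k)"
        using min[of k] k by (intro mult_right_mono) (auto simp: J_def)
      then show ?thesis using True by simp
    next
      case False
      then show ?thesis using nonneg[OF k] \<open>0 \<le> ?s\<close> by (intro add_nonneg_nonneg mult_nonneg_nonneg) auto
    qed
    show "a i + ?s * b i = 0" using bi by simp
  qed (use bi in auto)
qed

text \<open>The cross products with the opposite sides are, up to the factor \<open>D\<close>, the derivatives of the
  three barycentric coordinates in the direction \<open>f\<close>.\<close>

lemma barycentric_direction:
  fixes a b c f :: "real \<times> real"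
  assumes "D = cross (b - a) (c - a)" "D \<noteq> 0"
  shows "(cross (c - b) f / D) *\<^sub>R a + (cross (a - c) f / D) *\<^sub>R b + (cross (b - a) f / D) *\<^sub>R c = f"
    and "cross (c - b) f / D + cross (a - c) f / D + cross (b - a) f / D = 0"
proof -
  have "cross (c - b) f *\<^sub>R a + cross (a - c) f *\<^sub>R b + cross (b - a) f *\<^sub>R c = D *\<^sub>R f"
    unfolding assms(1) by (simp add: cross_def prod_eq_iff algebra_simps)
  then have "(1 / D) *\<^sub>R (cross (c - b) f *\<^sub>R a + cross (a - c) f *\<^sub>R b + cross (b - a) f *\<^sub>R c) = f"
    using assms(2) by simp
  then show "(cross (c - b) f / D) *\<^sub>R a + (cross (a - c) f / D) *\<^sub>R b + (cross (b - a) f / D) *\<^sub>R c = f"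
    by (simp add: scaleR_add_right)
  show "cross (c - b) f / D + cross (a - c) f / D + cross (b - a) f / D = 0"
    by (simp add: cross_simps diff_divide_distrib)
qed

text \<open>A step that leaves a counterclockwise triangle crosses one of its sides from left to right, so it
  ends within its own length of that side. In barycentric coordinates: the first coordinate that
  vanishes along the step is the one belonging to the vertex opposite the crossed side.\<close>

lemma triangle_exit:
  fixes a b c f z :: "real \<times> real"
  assumes pos: "cross (b - a) (c - a) > 0" and z: "z \<in> convex hull {a, b, c}"
    and out: "z + f \<notin> convex hull {a, b, c}"
  obtains p q y where "(p, q) \<in> {(a, b), (b, c), (c, a)}" "cross (q - p) f < 0"
    "y \<in> closed_segment p q" "dist (z + f) y \<le> norm f"
proof -
  define D where "D = cross (b - a) (c - a)"
  define l where "l = (\<lambda>k::nat. (if k = 0 then cross (c - b) f else if k = 1 then cross (a - c) f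
      else cross (b - a) f) / D)"
  have f: "l 0 *\<^sub>R a + l 1 *\<^sub>R b + l 2 *\<^sub>R c = f" "l 0 + l 1 + l 2 = 0"
    using barycentric_direction[OF D_def, of f] pos by (simp_all add: l_def D_def)
  obtain u v w where uvw: "z = u *\<^sub>R a + v *\<^sub>R b + w *\<^sub>R c" "0 \<le> u" "0 \<le> v" "0 \<le> w" "u + v + w = 1"
    using z unfolding convex_hull_3 by blast
  define m where "m = (\<lambda>k::nat. if k = 0 then u else if k = 1 then v else w)"
  have m: "z = m 0 *\<^sub>R a + m 1 *\<^sub>R b + m 2 *\<^sub>R c" "m 0 + m 1 + m 2 = 1" "\<And>k. 0 \<le> m k"
    using uvw by (simp_all add: m_def)
  have point: "z + s *\<^sub>R f
      = (m 0 + s * l 0) *\<^sub>R a + (m 1 + s * l 1) *\<^sub>R b + (m 2 + s * l 2) *\<^sub>R c" for s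
    unfolding m(1) by (subst f(1)[symmetric]) (simp add: algebra_simps)
  have total: "(m 0 + s * l 0) + (m 1 + s * l 1) + (m 2 + s * l 2) = 1" for s
  proof -
    have "(m 0 + s * l 0) + (m 1 + s * l 1) + (m 2 + s * l 2)
        = (m 0 + m 1 + m 2) + s * (l 0 + l 1 + l 2)" by (simp add: algebra_simps)
    then show ?thesis using f(2) m(2) by simp
  qed
  have "\<exists>j\<in>{0, 1, 2}. m j + l j < 0"
  proof (rule ccontr)
    assume "\<not> ?thesis"
    then have "z + f \<in> convex hull {a, b, c}"
      using point[of 1] total[of 1] unfolding convex_hull_3 by (force simp: not_less)
    with out show False by blast
  qed
  then obtain j where j: "j \<in> {0, 1, 2}" "m j + l j < 0" ..
  obtain s i where s: "0 \<le> s" "s \<le> 1" and ge: "\<And>i. i \<in> {0, 1, 2} \<Longrightarrow> m i + s * l i \<ge> 0"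
    and i: "i \<in> {0, 1, 2}" "l i < 0" "m i + s * l i = 0"
    using first_exit[of "{0, 1, 2}" m j l] j m(3) by auto
  \<comment> \<open>The coordinate \<open>i\<close> has just reached zero, hence \<open>z + s f\<close> lies on the side opposite vertex \<open>i\<close>.\<close>
  have ge': "m 0 + s * l 0 \<ge> 0" "m 1 + s * l 1 \<ge> 0" "m 2 + s * l 2 \<ge> 0"
    using ge by simp_all
  have "dist (z + f) (z + s *\<^sub>R f) = (1 - s) * norm f"
    using s by (simp add: dist_norm flip: scaleR_left_diff_distrib[of 1 s f, simplified])
  also have "\<dots> \<le> 1 * norm f" using s by (intro mult_right_mono) auto
  finally have near: "dist (z + f) (z + s *\<^sub>R f) \<le> norm f" by simp
  have seg: "x *\<^sub>R p + y *\<^sub>R q \<in> closed_segment p q" if "x + y = 1" "0 \<le> x" "0 \<le> y"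
    for x y and p q :: "real \<times> real"
    using that unfolding closed_segment_def by (auto intro!: exI[of _ y] simp: eq_diff_eq[symmetric])
  have sign: "x / D < 0 \<longleftrightarrow> x < 0" for x
    using pos by (simp add: D_def divide_less_0_iff)
  consider "i = 0" | "i = 1" | "i = 2" using i(1) by blast
  then show thesis
  proof cases
    case 1
    show thesis
      using that[of b c, OF _ _ _ near] point[of s] total[of s] ge' i(2,3) seg 1 sign
      by (simp add: l_def)
  next
    case 2
    show thesis
      using that[of c a, OF _ _ _ near] point[of s] total[of s] ge' i(2,3) 2 sign
        seg[of "m 2 + s * l 2" "m 0 + s * l 0" c a]
      by (simp add: l_def add.commute)
  next
    case 3
    show thesis
      using that[of a b, OF _ _ _ near] point[of s] total[of s] ge' i(2,3) seg 3 sign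
      by (simp add: l_def)
  qed
qed

lemma interior_triangle_nonempty:
  fixes a b c :: "real \<times> real"
  assumes "cross (b - a) (c - a) \<noteq> 0"
  shows "interior (convex hull {a, b, c}) \<noteq> {}"
proof -
  have "\<not> collinear {a, b, c}"
  proof
    assume "collinear {a, b, c}"
    then obtain u where u: "\<And>x y. x \<in> {a, b, c} \<Longrightarrow> y \<in> {a, b, c} \<Longrightarrow> \<exists>k. x - y = k *\<^sub>R u"
      unfolding collinear_def by blast
    obtain k l where "b - a = k *\<^sub>R u" "c - a = l *\<^sub>R u" using u[of b a] u[of c a] by auto
    with assms show False by (simp add: cross_simps)
  qed
  from interior_convex_hull_3_minimal[OF this]
  have "interior (convex hull {a, b, c})
      = {v. \<exists>x y z. 0 < x \<and> 0 < y \<and> 0 < z \<and> x + y + z = 1 \<and> x *\<^sub>R a + y *\<^sub>R b + z *\<^sub>R c = v}"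
    by simp
  moreover have "(1/3::real) > 0" "(1/3::real) + 1/3 + 1/3 = 1" by simp_all
  ultimately show ?thesis by blast
qed

section \<open>Coding a triangle from its sides\<close>

text \<open>For a vertex \<open>p\<close> of a coding polygon, \<open>F\<close> will be the set of displacements from \<open>p\<close> to the other
  lattice points of the polygon. By shift invariance, the symbol at the vertex is then determined
  by the rest of the polygon wherever the polygon is placed.\<close>

definition corner_rule :: "'a config set \<Rightarrow> (int \<times> int) set \<Rightarrow> bool" where
  "corner_rule X F \<longleftrightarrow>
     (\<forall>x\<in>X. \<forall>x'\<in>X. \<forall>u. (\<forall>f\<in>F. x (u + f) = x' (u + f)) \<longrightarrow> x u = x' u)"

text \<open>The directions for which all of \<open>F\<close> points strictly to the right. A strip in such a direction
  can be filled in on its left: the rule \<open>F\<close> determines a new point from points further right.\<close>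

definition corner_cone :: "(int \<times> int) set \<Rightarrow> (real \<times> real) set" where
  "corner_cone F = {v. \<forall>f\<in>F. cross v (lattice_pt f) < 0}"

text \<open>Among the points of \<open>T\<close> where two configurations differ that agree on \<open>D\<close>, take one furthest to
  the right in direction \<open>v\<close>. All its \<open>F\<close>-neighbours lie further right, so they are points of \<open>D\<close> or points of
  \<open>T\<close> where the configurations agree, and the rule forces agreement at the point itself.\<close>

lemma codes_by_corner_rule:
  assumes "corner_rule X F" "v \<in> corner_cone F" "bounded T"
    and step: "\<And>u f. lattice_pt u \<in> T \<Longrightarrow> f \<in> F \<Longrightarrow> lattice_pt (u + f) \<in> T \<union> D"
  shows "codes X D T"
  unfolding codes_def
proof (intro ballI impI)
  fix x x' assume x: "x \<in> X" "x' \<in> X" "agree_on D x x'"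
  define W where "W = {u. lattice_pt u \<in> T \<and> x u \<noteq> x' u}"
  have "finite W"
    using finite_lattice_points[OF assms(3)] by (rule rev_finite_subset) (auto simp: W_def)
  have "W = {}"
  proof (rule ccontr)
    assume "W \<noteq> {}"
    define u where "u = arg_min_on (\<lambda>u. cross v (lattice_pt u)) W"
    have u: "u \<in> W" and min: "\<And>w. w \<in> W \<Longrightarrow> cross v (lattice_pt u) \<le> cross v (lattice_pt w)"
      unfolding u_def using arg_min_if_finite[OF \<open>finite W\<close> \<open>W \<noteq> {}\<close>, of "\<lambda>u. cross v (lattice_pt u)"]
      by (auto simp: not_less)
    have "x (u + f) = x' (u + f)" if f: "f \<in> F" for f
    proof (rule ccontr)
      assume neq: "x (u + f) \<noteq> x' (u + f)"
      then have "lattice_pt (u + f) \<notin> D" using x(3) neq unfolding agree_on_def by blast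
      then have "u + f \<in> W" using step[of u f] u f neq by (auto simp: W_def)
      from min[OF this] have "cross v (lattice_pt f) \<ge> 0" by (simp add: lattice_pt_add cross_simps)
      then show False using assms(2) f by (auto simp: corner_cone_def)
    qed
    then have "x u = x' u" using assms(1) x unfolding corner_rule_def by blast
    then show False using u by (simp add: W_def)
  qed
  then show "agree_on T x x'" by (auto simp: agree_on_def W_def)
qed

text \<open>A counterclockwise side whose reversed direction lies in the cone is safe: no displacement in
  \<open>F\<close> crosses it outwards. Hence the filling procedure can leave the triangle only across the
  remaining sides, and there it lands in a neighbourhood of bounded radius.\<close>

lemma triangle_coded_by_sides:
  assumes "corner_rule X F" "v \<in> corner_cone F"
    and M: "\<And>f. f \<in> F \<Longrightarrow> norm (lattice_pt f) < M"
    and pos: "cross (b - a) (c - a) > 0"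
    and sides: "\<And>p q. (p, q) \<in> {(a, b), (b, c), (c, a)} \<Longrightarrow>
      closed_segment p q \<subseteq> B \<or> p - q \<in> corner_cone F"
  shows "codes X (lattice_nbhd B M) (convex hull {a, b, c})"
proof (rule codes_by_corner_rule[OF assms(1,2)])
  show "bounded (convex hull {a, b, c})" by (simp add: finite_imp_bounded bounded_convex_hull)
  fix u f assume u: "lattice_pt u \<in> convex hull {a, b, c}" and f: "f \<in> F"
  show "lattice_pt (u + f) \<in> convex hull {a, b, c} \<union> lattice_nbhd B M"
  proof (cases "lattice_pt u + lattice_pt f \<in> convex hull {a, b, c}")
    case True
    then show ?thesis by (simp add: lattice_pt_add)
  next
    case False
    then obtain p q y where pq: "(p, q) \<in> {(a, b), (b, c), (c, a)}"
      "cross (q - p) (lattice_pt f) < 0" "y \<in> closed_segment p q"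
      "dist (lattice_pt u + lattice_pt f) y \<le> norm (lattice_pt f)"
      using triangle_exit[OF pos u] by metis
    have "p - q \<notin> corner_cone F"
      using pq(2) f by (force simp: corner_cone_def cross_simps)
    with sides[OF pq(1)] pq(3) have "y \<in> B" by blast
    moreover have "dist (lattice_pt (u + f)) y < M"
      using pq(4) M[OF f] by (simp add: lattice_pt_add)
    ultimately have "lattice_pt (u + f) \<in> lattice_nbhd B M"
      by (subst mem_lattice_nbhd) auto
    then show ?thesis by blast
  qed
qed

context nonempty_Z2_shift
begin

text \<open>Under dilation by \<open>t\<close> the coding radius \<open>M\<close> does not change. A segment of the triangle becomes,
  after shrinking it slightly towards an interior point, a compact subset of the interior; its
  dilate then stays further from the boundary than any fixed \<open>r\<close>. So the patterns near the
  dilated segment are determined by those near the unsafe sides, whatever the radius \<open>r\<close>. The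
  slack \<open>e\<close> removes all considerations about the ends of the segment and disappears in the limit.\<close>

lemma segment_bound_from_triangle:
  assumes "corner_rule X F" "v \<in> corner_cone F"
    and M: "\<And>f. f \<in> F \<Longrightarrow> norm (lattice_pt f) < M"
    and pos: "cross (b - a) (c - a) > 0"
    and sides: "\<And>p q. (p, q) \<in> {(a, b), (b, c), (c, a)} \<Longrightarrow>
      closed_segment p q \<subseteq> B \<or> p - q \<in> corner_cone F"
    and B: "bounded B" "B \<noteq> {}"
    and d: "closed_segment p (p + d) \<subseteq> convex hull {a, b, c}"
    and e: "0 < e" "e < 1"
  shows "\<forall>\<^sub>F t in at_top.
    log_count (closed_segment 0 ((t * (1 - e)) *\<^sub>R d)) r \<le> log_count ((*\<^sub>R) t ` B) M"
proof -
  let ?T = "convex hull {a, b, c}"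
  obtain o' \<delta> where o: "\<delta> > 0" "ball o' \<delta> \<subseteq> ?T"
    using interior_triangle_nonempty[of b a c] pos mem_interior[of _ ?T] by fastforce
  \<comment> \<open>The ball around \<open>o'\<close> shrinks to a ball of radius \<open>e * \<delta>\<close> around every point of the shrunk segment.\<close>
  have shrink: "y \<in> ?T" if x: "x \<in> ?T" and y: "dist y ((1 - e) *\<^sub>R x + e *\<^sub>R o') < e * \<delta>" for x y
  proof -
    define z where "z = o' + (1 / e) *\<^sub>R (y - ((1 - e) *\<^sub>R x + e *\<^sub>R o'))"
    have "dist o' z = (1 / e) * dist y ((1 - e) *\<^sub>R x + e *\<^sub>R o')"
      using e by (simp add: z_def dist_norm)
    then have "dist o' z < \<delta>"
      using y e mult_less_cancel_left_pos[of "1 / e" "dist y ((1 - e) *\<^sub>R x + e *\<^sub>R o')" "e * \<delta>"]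
      by simp
    then have "z \<in> ?T" using o by auto
    then have "(1 - e) *\<^sub>R x + e *\<^sub>R z \<in> ?T"
      using x e convexD[OF convex_convex_hull[of "{a,b,c}"], of x z "1 - e" e] by simp
    moreover have "(1 - e) *\<^sub>R x + e *\<^sub>R z = y"
      using e by (simp add: z_def algebra_simps)
    ultimately show ?thesis by simp
  qed
  have "\<forall>\<^sub>F t in at_top. t > 0 \<and> t \<ge> (r + 1) / (e * \<delta>)"
    by (intro eventually_conj eventually_gt_at_top eventually_ge_at_top)
  then show ?thesis
  proof eventually_elim
    case (elim t)
    then have t: "t > 0" "r + 1 \<le> t * (e * \<delta>)" using e o(1) by (auto simp: field_simps)
    define w where "w = t *\<^sub>R ((1 - e) *\<^sub>R p + e *\<^sub>R o')"
    define S where "S = closed_segment 0 ((t * (1 - e)) *\<^sub>R d)"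
    have S: "bounded S" "S \<noteq> {}" by (auto simp: S_def bounded_closed_segment)
    have hull: "convex hull {t *\<^sub>R a, t *\<^sub>R b, t *\<^sub>R c} = (*\<^sub>R) t ` ?T"
      using convex_hull_scaling[of t "{a, b, c}"] by simp
    have codes: "codes X (lattice_nbhd ((*\<^sub>R) t ` B) M) ((*\<^sub>R) t ` ?T)"
      unfolding hull[symmetric]
    proof (rule triangle_coded_by_sides[OF assms(1,2) M])
      show "cross (t *\<^sub>R b - t *\<^sub>R a) (t *\<^sub>R c - t *\<^sub>R a) > 0"
        using pos t by (simp add: cross_simps flip: scaleR_diff_right)
      fix p' q' assume "(p', q') \<in> {(t *\<^sub>R a, t *\<^sub>R b), (t *\<^sub>R b, t *\<^sub>R c), (t *\<^sub>R c, t *\<^sub>R a)}"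
      then obtain p q where pq: "(p, q) \<in> {(a, b), (b, c), (c, a)}" "p' = t *\<^sub>R p" "q' = t *\<^sub>R q"
        by blast
      have "closed_segment p' q' = (*\<^sub>R) t ` closed_segment p q"
        unfolding pq(2,3) by (simp add: closed_segment_linear_image linear_scaleR)
      moreover have "p' - q' \<in> corner_cone F" if "p - q \<in> corner_cone F"
        using that t unfolding pq
        by (auto simp: corner_cone_def cross_simps mult_pos_neg simp flip: scaleR_diff_right)
      ultimately show "closed_segment p' q' \<subseteq> (*\<^sub>R) t ` B \<or> p' - q' \<in> corner_cone F"
        using sides[OF pq(1)] by blast
    qed
    have bB: "bounded (lattice_nbhd ((*\<^sub>R) t ` B) M)"
      using B by (intro bounded_lattice_nbhd bounded_scaling) auto
    have bT: "bounded ((*\<^sub>R) t ` ?T)"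
      by (intro bounded_scaling bounded_convex_hull finite_imp_bounded) simp
    \<comment> \<open>Translating by \<open>w\<close> puts the shrunk segment inside the dilated triangle and costs 1 in the radius.\<close>
    have "S = (+) (- w) ` (+) w ` S" by (simp add: image_image)
    then have "log_count S r \<le> log_count ((+) w ` S) (r + 1)"
      using log_count_translate[of "(+) w ` S" "- w" r] S by (simp add: bounded_translation)
    also have "\<dots> \<le> ln (real (pattern_count X ((*\<^sub>R) t ` ?T)))"
    proof (rule log_count_le)
      fix u assume "lattice_pt u \<in> lattice_nbhd ((+) w ` S) (r + 1)"
      then obtain s where s: "s \<in> S" "dist (lattice_pt u) (w + s) < r + 1"
        using S by (auto simp: mem_lattice_nbhd)
      then obtain k where k: "0 \<le> k" "k \<le> 1" "s = k *\<^sub>R (t * (1 - e)) *\<^sub>R d"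
        by (auto simp: S_def closed_segment_def)
      have x: "p + k *\<^sub>R d \<in> ?T"
        using d k by (force simp: closed_segment_def algebra_simps)
      have ws: "w + s = t *\<^sub>R ((1 - e) *\<^sub>R (p + k *\<^sub>R d) + e *\<^sub>R o')"
        by (simp add: w_def k algebra_simps)
      define y where "y = (1 / t) *\<^sub>R lattice_pt u"
      have y: "lattice_pt u = t *\<^sub>R y" using t by (simp add: y_def)
      have "dist (lattice_pt u) (w + s) = t * dist y ((1 - e) *\<^sub>R (p + k *\<^sub>R d) + e *\<^sub>R o')"
        unfolding y ws dist_norm scaleR_diff_right[symmetric] norm_scaleR using t by simp
      then have "t * dist y ((1 - e) *\<^sub>R (p + k *\<^sub>R d) + e *\<^sub>R o') < t * (e * \<delta>)"
        using s(2) t(2) by linarith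
      then have "y \<in> ?T" using t by (intro shrink[OF x]) simp
      then show "lattice_pt u \<in> (*\<^sub>R) t ` ?T" unfolding y by blast
    qed (use S bT in \<open>auto intro: bounded_translation\<close>)
    also have "\<dots> \<le> log_count ((*\<^sub>R) t ` B) M"
      using pattern_count_le_of_codes[OF codes bB] pattern_count_pos[OF bT]
      unfolding log_count_def by simp
    finally show ?case by (simp add: S_def)
  qed
qed

end

section \<open>Growth rates and local convexity\<close>

text \<open>A version of Fekete's lemma for a subadditivity that holds only up to a change of the radius.
  Here \<open>f\<close>, \<open>g\<close> and \<open>\<phi>\<close> stand for the logarithmic counts of a long segment with three increasing
  radii: the step from \<open>f\<close> to \<open>g\<close> is the radius lost by cutting a segment into \<open>k\<close> pieces, and
  \<open>upper\<close> says that a larger radius costs only a slightly longer segment. Then \<open>\<phi> t / t\<close>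
  is at least \<open>g t / t\<close> and in the limit at most any \<open>g s / s\<close>, so the rate is an infimum that does
  not depend on \<open>\<phi>\<close>.\<close>

lemma linear_growth_rate:
  fixes f g \<phi> :: "real \<Rightarrow> real"
  assumes nonneg: "\<And>s. s > 0 \<Longrightarrow> g s \<ge> 0"
    and mono: "\<And>s t. 0 < s \<Longrightarrow> s \<le> t \<Longrightarrow> f s \<le> f t"
    and sub: "\<And>s k. s > 0 \<Longrightarrow> k \<ge> 1 \<Longrightarrow> f (real k * s) \<le> real k * g s"
    and upper: "\<And>e. 0 < e \<Longrightarrow> e < 1 \<Longrightarrow> \<forall>\<^sub>F t in at_top. \<phi> (t * (1 - e)) \<le> f t"
    and lower: "\<And>t. t > 0 \<Longrightarrow> g t \<le> \<phi> t"
  shows "((\<lambda>t. \<phi> t / t) \<longlongrightarrow> (INF s\<in>{0<..}. g s / s)) at_top"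
proof (rule order_tendstoI)
  let ?L = "INF s\<in>{0<..}. g s / s"
  have bdd: "bdd_below ((\<lambda>s. g s / s) ` {0<..})"
    using nonneg by (intro bdd_belowI2[where m = 0]) auto
  {
    fix a assume a: "a < ?L"
    show "\<forall>\<^sub>F t in at_top. a < \<phi> t / t"
      using eventually_gt_at_top[of 0]
    proof eventually_elim
      case (elim t)
      have "?L \<le> g t / t" using bdd elim by (intro cINF_lower) auto
      also have "\<dots> \<le> \<phi> t / t" using lower[of t] elim by (intro divide_right_mono) auto
      finally show ?case using a by linarith
    qed
  next
    fix a assume "?L < a"
    then obtain s where s: "s > 0" "g s / s < a"
      using bdd by (subst (asm) cINF_less_iff) auto
    define c where "c = g s / s"
    have c: "0 \<le> c" "c < a" using s nonneg[of s] by (auto simp: c_def)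
    \<comment> \<open>Shortening by the factor \<open>1 - e\<close> moves \<open>a\<close> to the midpoint of \<open>c\<close> and \<open>a\<close>, still above the rate \<open>c\<close>.\<close>
    define e where "e = (a - c) / (2 * a)"
    have e: "0 < e" "e < 1" "a * (1 - e) = (a + c) / 2"
      using c by (auto simp: e_def field_simps)
    have "\<forall>\<^sub>F t in at_top. \<phi> (t * (1 - e)) < a * (t * (1 - e))"
      using upper[OF e(1,2)] eventually_gt_at_top[of 0] eventually_gt_at_top[of "g s * 2 / (a - c)"]
    proof eventually_elim
      case (elim t)
      \<comment> \<open>Cover \<open>[0, t]\<close> by copies of \<open>[0, s]\<close>.\<close>
      define k where "k = nat \<lceil>t / s\<rceil>"
      have ts: "t / s > 0" using elim s by simp
      then have "real k = of_int \<lceil>t / s\<rceil>" by (simp add: k_def)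
      with ceiling_correct[of "t / s"] have "t / s \<le> real k" "real k \<le> t / s + 1" by linarith+
      moreover from this have "k \<ge> 1" using ts by linarith
      ultimately have k: "k \<ge> 1" "t \<le> real k * s" "real k \<le> t / s + 1"
        using s by (auto simp: field_simps)
      have "\<phi> (t * (1 - e)) \<le> f t" using elim by simp
      also have "\<dots> \<le> f (real k * s)" using mono elim k by blast
      also have "\<dots> \<le> real k * g s" using sub s k by blast
      also have "\<dots> \<le> (t / s + 1) * g s" using nonneg[OF s(1)] k by (intro mult_right_mono)
      also have "\<dots> = c * t + g s" using s by (simp add: c_def field_simps)
      also have "\<dots> < (a + c) / 2 * t" using elim c by (simp add: field_simps)
      also have "\<dots> = a * (t * (1 - e))" using e(3) by (metis mult.assoc mult.commute)
      finally show ?case .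
    qed
    moreover have "filterlim (\<lambda>t. t / (1 - e)) at_top at_top"
      using e by (intro filterlim_tendsto_pos_mult_at_top[OF tendsto_const _ filterlim_ident, of "1/(1-e)", simplified]) auto
    ultimately have "\<forall>\<^sub>F t in at_top. \<phi> (t / (1 - e) * (1 - e)) < a * (t / (1 - e) * (1 - e))"
      by (rule eventually_compose_filterlim)
    moreover have "t / (1 - e) * (1 - e) = t" for t using e by simp
    ultimately have "\<forall>\<^sub>F t in at_top. \<phi> t < a * t" by simp
    then show "\<forall>\<^sub>F t in at_top. \<phi> t / t < a"
      using eventually_gt_at_top[of 0] by eventually_elim (simp add: divide_less_eq)
  }
qed

text \<open>Subtract the chord over \<open>[a, b]\<close>. If the difference \<open>\<psi>\<close> were somewhere positive, consider the last
  point where its maximum is attained: on its right \<open>\<psi>\<close> is strictly smaller and on its left not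
  larger, which contradicts convexity near that point.\<close>

lemma locally_convex_imp_convex:
  fixes \<phi> :: "real \<Rightarrow> real"
  assumes local: "\<And>x. \<exists>e>0. convex_on (ball x e) \<phi>"
  shows "convex_on UNIV \<phi>"
proof (rule convex_on_linorderI)
  have cont: "isCont \<phi> x" for x
  proof -
    obtain e where "e > 0" "convex_on (ball x e) \<phi>" using local by blast
    then show ?thesis
      using convex_on_continuous[of "ball x e" \<phi>] continuous_on_eq_continuous_at[of "ball x e" \<phi>]
      by auto
  qed
  fix u a b :: real
  assume u: "0 < u" "u < 1" and ab: "a < b"
  define c where "c = (\<phi> b - \<phi> a) / (b - a)"
  have slope: "(b - a) * c = \<phi> b - \<phi> a" using ab by (simp add: c_def)
  define \<psi> where "\<psi> = (\<lambda>x. \<phi> x - (\<phi> a + (x - a) * c))"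
  have ends: "\<psi> a = 0" "\<psi> b = 0" using slope by (simp_all add: \<psi>_def)
  have cont': "continuous_on S \<psi>" for S
    unfolding \<psi>_def using cont by (intro continuous_intros continuous_at_imp_continuous_on) auto
  obtain m where m: "m \<in> {a..b}" "\<And>y. y \<in> {a..b} \<Longrightarrow> \<psi> y \<le> \<psi> m"
    using continuous_attains_sup[OF compact_Icc[of a b] _ cont'] ab by fastforce
  have "\<psi> m \<le> 0"
  proof (rule ccontr)
    assume "\<not> \<psi> m \<le> 0"
    define K where "K = {a..b} \<inter> {x. \<psi> x = \<psi> m}"
    have "compact K"
      unfolding K_def by (intro compact_Int_closed[OF compact_Icc] closed_Collect_eq cont' continuous_on_const)
    moreover have "m \<in> K" using m by (simp add: K_def)
    ultimately obtain z where z: "z \<in> K" "\<And>y. y \<in> K \<Longrightarrow> y \<le> z"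
      using compact_attains_sup[of K] by blast
    then have zm: "a \<le> z" "z \<le> b" "\<psi> z = \<psi> m" by (simp_all add: K_def)
    have "z \<noteq> a" using zm(3) \<open>\<not> \<psi> m \<le> 0\<close> ends(1) by force
    moreover have "z \<noteq> b" using zm(3) \<open>\<not> \<psi> m \<le> 0\<close> ends(2) by force
    ultimately have zab: "a < z" "z < b" using zm by linarith+
    obtain e where e: "e > 0" "convex_on (ball z e) \<phi>" using local by blast
    define d where "d = min (e / 2) (min (z - a) (b - z))"
    have d: "d > 0" "d < e" "a \<le> z - d" "z + d \<le> b" using e zab by (auto simp: d_def)
    have "\<phi> ((1 - 1/2) *\<^sub>R (z - d) + (1/2) *\<^sub>R (z + d)) \<le> (1 - 1/2) * \<phi> (z - d) + 1/2 * \<phi> (z + d)"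
      using d by (intro convex_onD[OF e(2)]) (auto simp: dist_real_def)
    moreover have "(1 - 1/2) *\<^sub>R (z - d) + (1/2) *\<^sub>R (z + d) = z" by (simp add: field_simps)
    ultimately have "2 * \<phi> z \<le> \<phi> (z - d) + \<phi> (z + d)" by simp
    then have "2 * \<psi> z \<le> \<psi> (z - d) + \<psi> (z + d)"
      by (simp add: \<psi>_def algebra_simps)
    moreover have "\<psi> (z - d) \<le> \<psi> m" using m(2) d zab by auto
    moreover have "\<psi> (z + d) < \<psi> m"
    proof (rule ccontr)
      assume "\<not> ?thesis"
      then have "z + d \<in> K" using m(2)[of "z + d"] d zab by (auto simp: K_def)
      then show False using z(2) d by fastforce
    qed
    ultimately show False using zm(3) by linarith
  qed
  moreover have "(1 - u) * a + u * b \<in> {a..b}"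
    using u ab convexD_alt[of "{a..b}" a b u] by simp
  ultimately have "\<psi> ((1 - u) * a + u * b) \<le> 0" using m(2) by fastforce
  moreover have "((1 - u) * a + u * b - a) * c = u * (\<phi> b - \<phi> a)"
    unfolding slope[symmetric] by (simp add: algebra_simps)
  ultimately show "\<phi> ((1 - u) *\<^sub>R a + u *\<^sub>R b) \<le> (1 - u) * \<phi> a + u * \<phi> b"
    by (simp add: \<psi>_def algebra_simps)
qed simp

lemma parallel_if_cross_zero:
  assumes "cross v w = 0" "v \<noteq> 0"
  obtains c where "w = c *\<^sub>R v"
proof -
  define n where "n = (- snd v, fst v)"
  have n: "cross v n \<noteq> 0"
    using assms(2) by (auto simp: n_def cross_def prod_eq_iff sum_squares_eq_zero_iff zero_prod_def)
  have "cross v n *\<^sub>R w = cross w n *\<^sub>R v"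
    using linear_combination_cross[of v n w] assms(1) by simp
  moreover have "w = (1 / cross v n) *\<^sub>R cross v n *\<^sub>R w" using n by simp
  ultimately have "w = (cross w n / cross v n) *\<^sub>R v" by simp
  then show thesis using that by blast
qed

lemma subadditive_on_parallel_vectors:
  fixes h :: "real \<times> real \<Rightarrow> real"
  assumes nonneg: "\<And>v. h v \<ge> 0" and homogeneous: "\<And>c v. h (c *\<^sub>R v) = \<bar>c\<bar> * h v"
    and "cross v w = 0"
  shows "h (v + w) \<le> h v + h w"
proof (cases "v = 0")
  case False
  then obtain c where w: "w = c *\<^sub>R v" using parallel_if_cross_zero assms(3) by blast
  have "v + w = (1 + c) *\<^sub>R v" by (simp add: w algebra_simps)
  then have "h (v + w) = \<bar>1 + c\<bar> * h v" by (metis homogeneous)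
  also have "\<dots> \<le> (1 + \<bar>c\<bar>) * h v" using nonneg by (intro mult_right_mono) auto
  also have "\<dots> = h v + h w" by (simp add: w homogeneous algebra_simps)
  finally show ?thesis .
qed (use nonneg in simp)

text \<open>If \<open>v\<close> and \<open>w\<close> are not parallel, the line through them avoids the origin, so \<open>h\<close> is locally
  convex, hence convex, along it; the midpoint of \<open>v\<close> and \<open>w\<close> gives the inequality.\<close>

lemma subadditive_if_locally_convex:
  fixes h :: "real \<times> real \<Rightarrow> real"
  assumes nonneg: "\<And>v. h v \<ge> 0" and homogeneous: "\<And>c v. h (c *\<^sub>R v) = \<bar>c\<bar> * h v"
    and local: "\<And>v. v \<noteq> 0 \<Longrightarrow> \<exists>C. open C \<and> v \<in> C \<and> (\<forall>x\<in>C. \<forall>y\<in>C. \<forall>a>0. \<forall>b>0.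
       h (a *\<^sub>R x + b *\<^sub>R y) \<le> a * h x + b * h y)"
  shows "h (v + w) \<le> h v + h w"
proof (cases "cross v w = 0")
  case True
  then show ?thesis by (rule subadditive_on_parallel_vectors[OF nonneg homogeneous])
next
  case False
  define \<phi> where "\<phi> = (\<lambda>t. h (v + t *\<^sub>R (w - v)))"
  have "\<exists>e>0. convex_on (ball x e) \<phi>" for x
  proof -
    have "v + x *\<^sub>R (w - v) \<noteq> 0"
    proof
      assume "v + x *\<^sub>R (w - v) = 0"
      then have "cross (v + x *\<^sub>R (w - v)) (w - v) = 0" by (simp add: cross_simps)
      moreover have "cross (v + x *\<^sub>R (w - v)) (w - v) = cross v w"
        by (simp add: cross_simps cross_swap[of w v])
      ultimately show False using False by simp
    qed
    then obtain C where C: "open C" "v + x *\<^sub>R (w - v) \<in> C"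
      "\<And>y z a b. y \<in> C \<Longrightarrow> z \<in> C \<Longrightarrow> a > 0 \<Longrightarrow> b > 0 \<Longrightarrow> h (a *\<^sub>R y + b *\<^sub>R z) \<le> a * h y + b * h z"
      using local by metis
    have "open ((\<lambda>t. v + t *\<^sub>R (w - v)) -` C)"
      by (intro open_vimage C continuous_intros)
    with C(2) obtain e where e: "e > 0" "ball x e \<subseteq> (\<lambda>t. v + t *\<^sub>R (w - v)) -` C"
      by (metis openE vimageI2)
    have "convex_on (ball x e) \<phi>"
    proof (rule convex_onI)
      fix t y z :: real assume t: "0 < t" "t < 1" and yz: "y \<in> ball x e" "z \<in> ball x e"
      have "v + ((1 - t) *\<^sub>R y + t *\<^sub>R z) *\<^sub>R (w - v)
          = (1 - t) *\<^sub>R (v + y *\<^sub>R (w - v)) + t *\<^sub>R (v + z *\<^sub>R (w - v))"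
        by (simp add: algebra_simps)
      moreover have "v + y *\<^sub>R (w - v) \<in> C" "v + z *\<^sub>R (w - v) \<in> C" using e(2) yz by blast+
      ultimately show "\<phi> ((1 - t) *\<^sub>R y + t *\<^sub>R z) \<le> (1 - t) * \<phi> y + t * \<phi> z"
        unfolding \<phi>_def using C(3)[of "v + y *\<^sub>R (w - v)" "v + z *\<^sub>R (w - v)" "1 - t" t] t
        by simp
    qed simp
    with e show ?thesis by blast
  qed
  then have "convex_on UNIV \<phi>" by (rule locally_convex_imp_convex)
  from convex_onD[OF this, of "1/2" 0 1]
  have "h (v + (1 / 2) *\<^sub>R (w - v)) \<le> (h v + h w) / 2"
    by (simp add: \<phi>_def)
  moreover have "v + (1 / 2) *\<^sub>R (w - v) = (1 / 2) *\<^sub>R (v + w)"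
    by (simp add: prod_eq_iff field_simps)
  ultimately have "h ((1 / 2) *\<^sub>R (v + w)) \<le> (h v + h w) / 2" by simp
  then show ?thesis by (simp add: homogeneous)
qed

section \<open>Directional entropy of a shift with corner rules\<close>

lemma open_corner_cone:
  assumes "finite F"
  shows "open (corner_cone F)"
proof -
  have "corner_cone F = (\<Inter>f\<in>F. {v. cross v (lattice_pt f) < 0})"
    by (auto simp: corner_cone_def)
  then show ?thesis
    unfolding cross_def using assms
    by (auto intro!: open_INT open_Collect_less continuous_intros)
qed

lemma corner_cone_add: "v \<in> corner_cone F \<Longrightarrow> w \<in> corner_cone F \<Longrightarrow> v + w \<in> corner_cone F"
  by (auto simp: corner_cone_def cross_simps intro: add_neg_neg)

lemma corner_cone_scale: "v \<in> corner_cone F \<Longrightarrow> c > 0 \<Longrightarrow> c *\<^sub>R v \<in> corner_cone F"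
  by (auto simp: corner_cone_def cross_simps mult_pos_neg)

text \<open>The cone is open, so half of \<open>v\<close> may be turned slightly to either side. Together \<open>d\<close> and \<open>v - d\<close>
  are the two upper sides of a thin triangle over \<open>v\<close>, both of them safe.\<close>

lemma split_in_corner_cone:
  assumes "finite F" "v \<in> corner_cone F" "v \<noteq> 0"
  obtains d where "d \<in> corner_cone F" "v - d \<in> corner_cone F" "cross v d > 0"
proof -
  define n where "n = (- snd v, fst v)"
  have n: "cross v n > 0"
    using assms(3) by (auto simp: n_def cross_def prod_eq_iff zero_prod_def
        add_nonneg_eq_0_iff less_le simp flip: power2_eq_square)
  have "(1/2) *\<^sub>R v \<in> corner_cone F" using corner_cone_scale assms(2) by auto
  then obtain \<rho> where \<rho>: "\<rho> > 0" "ball ((1/2) *\<^sub>R v) \<rho> \<subseteq> corner_cone F"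
    using open_corner_cone[OF assms(1)] openE by blast
  define \<delta> where "\<delta> = \<rho> / (norm n + 1)"
  have \<delta>: "\<delta> > 0" using \<rho> by (simp add: \<delta>_def add_nonneg_pos)
  have "\<delta> * norm n < \<delta> * (norm n + 1)" using \<delta> by simp
  moreover have "norm n + 1 \<noteq> 0" using norm_ge_zero[of n] by linarith
  then have "\<delta> * (norm n + 1) = \<rho>" by (simp add: \<delta>_def)
  ultimately have small: "\<delta> * norm n < \<rho>" by linarith
  show thesis
  proof
    show "(1/2) *\<^sub>R v + \<delta> *\<^sub>R n \<in> corner_cone F"
      using \<rho>(2) small \<delta> by (force simp: dist_norm)
    have *: "v - ((1/2) *\<^sub>R v + \<delta> *\<^sub>R n) = (1/2) *\<^sub>R v - \<delta> *\<^sub>R n"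
      by (simp add: prod_eq_iff field_simps)
    show "v - ((1/2) *\<^sub>R v + \<delta> *\<^sub>R n) \<in> corner_cone F"
      unfolding * using \<rho>(2) small \<delta> by (force simp: dist_norm)
    show "cross v ((1/2) *\<^sub>R v + \<delta> *\<^sub>R n) > 0" using n \<delta> by (simp add: cross_simps)
  qed
qed

context nonempty_Z2_shift
begin

lemma log_count_path:
  "log_count (closed_segment 0 v \<union> closed_segment v (v + w)) r
    \<le> log_count (closed_segment 0 v) r + log_count (closed_segment 0 w) (r + 1)"
proof -
  have "closed_segment v (v + w) = (+) v ` closed_segment 0 w"
    using closed_segment_translation[of v 0 w] by simp
  then have "log_count (closed_segment v (v + w)) r \<le> log_count (closed_segment 0 w) (r + 1)"
    using log_count_translate[of "closed_segment 0 w" v r] by (simp add: bounded_closed_segment)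
  moreover have "log_count (closed_segment 0 v \<union> closed_segment v (v + w)) r
      \<le> log_count (closed_segment 0 v) r + log_count (closed_segment v (v + w)) r"
    by (intro log_count_Un) (auto simp: bounded_closed_segment)
  ultimately show ?thesis by linarith
qed

lemma log_count_segment_multiple:
  assumes "k \<ge> 1"
  shows "log_count (closed_segment 0 (real k *\<^sub>R v)) r \<le> real k * log_count (closed_segment 0 v) (r + 1)"
  using assms
proof (induction k rule: dec_induct)
  case base
  show ?case by (simp add: log_count_mono bounded_closed_segment)
next
  case (step k)
  have "closed_segment 0 (real (Suc k) *\<^sub>R v)
      \<subseteq> closed_segment 0 (real k *\<^sub>R v) \<union> closed_segment (real k *\<^sub>R v) (real k *\<^sub>R v + v)"
  proof
    fix x assume "x \<in> closed_segment 0 (real (Suc k) *\<^sub>R v)"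
    then obtain s where s: "0 \<le> s" "s \<le> 1" "x = (s * real (Suc k)) *\<^sub>R v"
      by (auto simp: closed_segment_def)
    show "x \<in> closed_segment 0 (real k *\<^sub>R v) \<union> closed_segment (real k *\<^sub>R v) (real k *\<^sub>R v + v)"
    proof (cases "s * real (Suc k) \<le> real k")
      case True
      then have "x = (s * real (Suc k) / real k) *\<^sub>R (real k *\<^sub>R v)"
        using step.hyps s by simp
      moreover have "0 \<le> s * real (Suc k) / real k" "s * real (Suc k) / real k \<le> 1"
        using True step.hyps s by (auto simp: divide_le_eq)
      ultimately have "x \<in> closed_segment 0 (real k *\<^sub>R v)"
        unfolding closed_segment_def mem_Collect_eq by (metis scaleR_zero_right add_0)
      then show ?thesis by blast
    next
      case False
      define q where "q = s * real (Suc k) - real k"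
      have "s * real (Suc k) \<le> real (Suc k)" using s by (intro mult_left_le_one_le) auto
      then have q: "0 \<le> q" "q \<le> 1" using False unfolding q_def of_nat_Suc by linarith+
      have "x = (1 - q) *\<^sub>R (real k *\<^sub>R v) + q *\<^sub>R (real k *\<^sub>R v + v)"
        unfolding s q_def by (simp add: algebra_simps)
      then show ?thesis using q unfolding closed_segment_def by auto
    qed
  qed
  then have "log_count (closed_segment 0 (real (Suc k) *\<^sub>R v)) r
      \<le> log_count (closed_segment 0 (real k *\<^sub>R v) \<union> closed_segment (real k *\<^sub>R v) (real k *\<^sub>R v + v)) r"
    by (intro log_count_mono) (auto simp: bounded_closed_segment)
  also have "\<dots> \<le> log_count (closed_segment 0 (real k *\<^sub>R v)) r + log_count (closed_segment 0 v) (r + 1)"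
    by (rule log_count_path)
  finally show ?case using step.IH by (simp add: algebra_simps)
qed

lemma log_count_segment_minus:
  "log_count (closed_segment 0 (- v)) r \<le> log_count (closed_segment 0 v) (r + 1)"
proof -
  have "closed_segment 0 (- v) = (+) (- v) ` closed_segment 0 v"
    using closed_segment_translation[of "- v" 0 v] by (simp add: closed_segment_commute)
  then show ?thesis
    using log_count_translate[of "closed_segment 0 v" "- v" r] by (simp add: bounded_closed_segment)
qed

lemma log_count_segment_mono:
  assumes "0 \<le> s" "s \<le> t" "r \<le> r'"
  shows "log_count (closed_segment 0 (s *\<^sub>R v)) r \<le> log_count (closed_segment 0 (t *\<^sub>R v)) r'"
proof (rule log_count_mono[OF _ assms(3)])
  show "closed_segment 0 (s *\<^sub>R v) \<subseteq> closed_segment 0 (t *\<^sub>R v)"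
  proof (cases "t = 0")
    case False
    then have "s *\<^sub>R v = (s / t) *\<^sub>R (t *\<^sub>R v)" "0 \<le> s / t" "s / t \<le> 1" using assms by auto
    then have "s *\<^sub>R v \<in> closed_segment 0 (t *\<^sub>R v)"
      unfolding closed_segment_def by (auto intro: exI[of _ "s / t"])
    then show ?thesis by (simp add: subset_closed_segment)
  qed (use assms in simp)
qed (auto simp: bounded_closed_segment)

end

text \<open>What the polygon contributes: finitely many displacements of bounded length at each vertex, with
  cones that together with their negatives cover all directions. The bound \<open>M\<close> is uniform in the
  vertices, so that one radius serves all directions.\<close>

locale corner_coded_shift = nonempty_Z2_shift A X
  for A :: "'a set" and X :: "'a config set" +
  fixes \<F> :: "(int \<times> int) set set" and M :: real
  assumes corner: "F \<in> \<F> \<Longrightarrow> corner_rule X F"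
    and finite_corner: "F \<in> \<F> \<Longrightarrow> finite F"
    and corner_bound: "F \<in> \<F> \<Longrightarrow> f \<in> F \<Longrightarrow> norm (lattice_pt f) < M"
    and cones_cover: "v \<noteq> 0 \<Longrightarrow> \<exists>F\<in>\<F>. v \<in> corner_cone F \<or> - v \<in> corner_cone F"
begin

text \<open>In the triangle with base \<open>v\<close> and upper sides \<open>d\<close> and \<open>v - d\<close> only the base is unsafe. For
  \<open>x = v\<close> this says that thickening a strip in direction \<open>v\<close> adds no entropy; for \<open>x = d\<close> that a
  second direction has at most the entropy of \<open>v\<close>.\<close>

lemma thin_triangle_bounds:
  assumes F: "F \<in> \<F>" and v: "v \<in> corner_cone F" "v \<noteq> 0"
  shows "\<exists>d. cross v d > 0 \<and> (\<forall>x\<in>{v, d}. \<forall>r. \<forall>e\<in>{0<..<1}. \<forall>\<^sub>F t in at_top.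
    log_count (closed_segment 0 ((t * (1 - e)) *\<^sub>R x)) r \<le> log_count (closed_segment 0 (t *\<^sub>R v)) M)"
proof -
  obtain d where d: "d \<in> corner_cone F" "v - d \<in> corner_cone F" "cross v d > 0"
    using split_in_corner_cone[OF finite_corner[OF F] v] .
  have scaled: "(*\<^sub>R) t ` closed_segment 0 v = closed_segment 0 (t *\<^sub>R v)" for t
    using closed_segment_linear_image[of "(*\<^sub>R) t" 0 v] by (simp add: linear_scaleR)
  have bound: "\<forall>\<^sub>F t in at_top.
      log_count (closed_segment 0 ((t * (1 - e)) *\<^sub>R x)) r \<le> log_count (closed_segment 0 (t *\<^sub>R v)) M"
    if e: "0 < e" "e < 1" and x: "x \<in> {v, d}" for r e x
  proof -
    have "closed_segment 0 (0 + x) \<subseteq> convex hull {0, v, d}"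
      using x by (simp add: closed_segment_subset_convex_hull hull_inc)
    moreover have "closed_segment p q \<subseteq> closed_segment 0 v \<or> p - q \<in> corner_cone F"
      if "(p, q) \<in> {(0, v), (v, d), (d, 0)}" for p q
      using that d by auto
    ultimately show ?thesis
      using segment_bound_from_triangle[OF corner[OF F] v(1) corner_bound[OF F], where
          a = 0 and b = v and c = d and B = "closed_segment 0 v" and p = 0 and d = x] d(3) e
      unfolding scaled by (simp add: bounded_closed_segment)
  qed
  with d(3) show ?thesis by (meson greaterThanLessThan_iff)
qed

text \<open>When only \<open>- v\<close> lies in a cone, reversing the segment costs 1 in the radius; hence \<open>M + 1\<close>.\<close>

lemma segment_thickening:
  assumes "v \<noteq> 0" "0 < e" "e < 1"
  shows "\<forall>\<^sub>F t in at_top. log_count (closed_segment 0 ((t * (1 - e)) *\<^sub>R v)) r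
    \<le> log_count (closed_segment 0 (t *\<^sub>R v)) (M + 1)"
proof -
  obtain F where F: "F \<in> \<F>" "v \<in> corner_cone F \<or> - v \<in> corner_cone F"
    using cones_cover assms(1) by blast
  show ?thesis
  proof (cases "v \<in> corner_cone F")
    case True
    have "\<forall>\<^sub>F t in at_top. log_count (closed_segment 0 ((t * (1 - e)) *\<^sub>R v)) r
        \<le> log_count (closed_segment 0 (t *\<^sub>R v)) M"
      using thin_triangle_bounds[OF F(1) True assms(1)] assms(2,3) by auto
    moreover have "log_count (closed_segment 0 (t *\<^sub>R v)) M
        \<le> log_count (closed_segment 0 (t *\<^sub>R v)) (M + 1)" for t
      by (intro log_count_mono) (auto simp: bounded_closed_segment)
    ultimately show ?thesis by (auto elim!: eventually_mono intro: order_trans)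
  next
    case False
    with F have w: "- v \<in> corner_cone F" by blast
    have "\<forall>\<^sub>F t in at_top. log_count (closed_segment 0 ((t * (1 - e)) *\<^sub>R (- v))) (r + 1)
        \<le> log_count (closed_segment 0 (t *\<^sub>R (- v))) M"
      using thin_triangle_bounds[OF F(1) w] assms by (auto simp del: scaleR_minus_right)
    then show ?thesis
    proof eventually_elim
      case (elim t)
      show ?case
        using elim log_count_segment_minus[of "(t * (1 - e)) *\<^sub>R (- v)" r]
          log_count_segment_minus[of "t *\<^sub>R v" M] by simp
    qed
  qed
qed

text \<open>Both limits in the definition of the entropy exist. The outer one is trivial: from radius \<open>M + 2\<close>
  on, the inner limit does not depend on the radius. Taking the inner limit along real \<open>t\<close> rather
  than integers makes homogeneity a substitution.\<close>

lemma directional_entropy_tendsto: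
  assumes "r \<ge> M + 2"
  shows "((\<lambda>t. log_count (closed_segment 0 (t *\<^sub>R v)) r / t) \<longlongrightarrow> directional_entropy X v) at_top"
proof -
  have "\<exists>L. \<forall>r\<ge>M + 2. ((\<lambda>t. log_count (closed_segment 0 (t *\<^sub>R v)) r / t) \<longlongrightarrow> L) at_top"
  proof (cases "v = 0")
    case True
    have "((\<lambda>t. log_count {0} r / t) \<longlongrightarrow> 0) at_top" for r
      by (rule real_tendsto_divide_at_top[OF tendsto_const filterlim_ident])
    then show ?thesis using True by auto
  next
    case False
    have "((\<lambda>t. log_count (closed_segment 0 (t *\<^sub>R v)) r / t)
        \<longlongrightarrow> (INF s\<in>{0<..}. log_count (closed_segment 0 (s *\<^sub>R v)) (M + 2) / s)) at_top"
      if r: "r \<ge> M + 2" for r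
    proof (rule linear_growth_rate[where f = "\<lambda>t. log_count (closed_segment 0 (t *\<^sub>R v)) (M + 1)"])
      show "log_count (closed_segment 0 (s *\<^sub>R v)) (M + 2) \<ge> 0" for s
        by (intro log_count_nonneg) (auto simp: bounded_closed_segment)
      show "log_count (closed_segment 0 (s *\<^sub>R v)) (M + 1) \<le> log_count (closed_segment 0 (t *\<^sub>R v)) (M + 1)"
        if "0 < s" "s \<le> t" for s t
        using that by (intro log_count_segment_mono) auto
      show "log_count (closed_segment 0 ((real k * s) *\<^sub>R v)) (M + 1)
          \<le> real k * log_count (closed_segment 0 (s *\<^sub>R v)) (M + 2)" if "k \<ge> 1" for s k
        using log_count_segment_multiple[OF that, of "s *\<^sub>R v" "M + 1"] by (simp add: algebra_simps)
      show "\<forall>\<^sub>F t in at_top. log_count (closed_segment 0 ((t * (1 - e)) *\<^sub>R v)) r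
          \<le> log_count (closed_segment 0 (t *\<^sub>R v)) (M + 1)" if "0 < e" "e < 1" for e
        using segment_thickening[OF False that] .
      show "log_count (closed_segment 0 (t *\<^sub>R v)) (M + 2) \<le> log_count (closed_segment 0 (t *\<^sub>R v)) r" for t
        using r by (intro log_count_mono) (auto simp: bounded_closed_segment)
    qed
    then show ?thesis by blast
  qed
  then obtain L where L: "\<And>r. r \<ge> M + 2 \<Longrightarrow>
      ((\<lambda>t. log_count (closed_segment 0 (t *\<^sub>R v)) r / t) \<longlongrightarrow> L) at_top" by blast
  have seg: "(*\<^sub>R) (real n) ` {t *\<^sub>R v |t. t \<in> {0..1}} = closed_segment 0 (real n *\<^sub>R v)" for n
  proof -
    have "{t *\<^sub>R v |t. t \<in> {0..1}} = closed_segment 0 v" by (auto simp: closed_segment_def)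
    then show ?thesis
      using closed_segment_linear_image[of "(*\<^sub>R) (real n)" 0 v] by (simp add: linear_scaleR)
  qed
  have "lim (\<lambda>n. ln (real (pattern_count X (lattice_nbhd
      ((*\<^sub>R) (real n) ` {t *\<^sub>R v |t. t \<in> {0..1}}) r))) / real n) = L" if r: "r \<ge> M + 2" for r
    unfolding seg
    using filterlim_compose[OF L[OF r] filterlim_real_sequentially]
    by (intro limI) (simp add: log_count_def)
  then have "\<forall>\<^sub>F r in at_top. lim (\<lambda>n. ln (real (pattern_count X (lattice_nbhd
      ((*\<^sub>R) (real n) ` {t *\<^sub>R v |t. t \<in> {0..1}}) r))) / real n) = L"
    using eventually_ge_at_top[of "M + 2"] by (rule eventually_mono[rotated])
  then have "directional_entropy X v = L"
    unfolding directional_entropy_def polygon_entropy_def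
    by (rule tendsto_Lim[OF trivial_limit_at_top_linorder tendsto_eventually])
  then show ?thesis using L[OF assms] by simp
qed

lemma directional_entropy_nonneg: "directional_entropy X v \<ge> 0"
proof (rule tendsto_lowerbound[OF directional_entropy_tendsto[OF order_refl]])
  show "\<forall>\<^sub>F t in at_top. 0 \<le> log_count (closed_segment 0 (t *\<^sub>R v)) (M + 2) / t"
    using eventually_gt_at_top[of 0]
    by eventually_elim (simp add: log_count_nonneg bounded_closed_segment)
qed simp

lemma directional_entropy_pos_scale:
  assumes "c > 0"
  shows "directional_entropy X (c *\<^sub>R v) = c * directional_entropy X v"
proof -
  have "filterlim (\<lambda>t. t * c) at_top at_top"
    using assms filterlim_at_top_mult_tendsto_pos[OF tendsto_const _ filterlim_ident, of c] by simp
  from filterlim_compose[OF directional_entropy_tendsto[OF order_refl, of v] this]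
  have "((\<lambda>t. c * (log_count (closed_segment 0 ((t * c) *\<^sub>R v)) (M + 2) / (t * c)))
      \<longlongrightarrow> c * directional_entropy X v) at_top"
    by (intro tendsto_mult_left)
  then have "((\<lambda>t. log_count (closed_segment 0 (t *\<^sub>R c *\<^sub>R v)) (M + 2) / t)
      \<longlongrightarrow> c * directional_entropy X v) at_top"
    using assms by simp
  from tendsto_unique[OF trivial_limit_at_top_linorder
      directional_entropy_tendsto[OF order_refl, of "c *\<^sub>R v"] this]
  show ?thesis .
qed

lemma directional_entropy_zero: "directional_entropy X 0 = 0"
  using directional_entropy_pos_scale[of 2 0] by simp

lemma directional_entropy_minus: "directional_entropy X (- v) = directional_entropy X v"
proof -
  have "directional_entropy X (- v) \<le> directional_entropy X v" for v
  proof (rule tendsto_le[OF _ directional_entropy_tendsto directional_entropy_tendsto])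
    show "\<forall>\<^sub>F t in at_top. log_count (closed_segment 0 (t *\<^sub>R - v)) (M + 2) / t
        \<le> log_count (closed_segment 0 (t *\<^sub>R v)) (M + 3) / t"
      using eventually_gt_at_top[of 0]
    proof eventually_elim
      case (elim t)
      then show ?case
        using log_count_segment_minus[of "t *\<^sub>R v" "M + 2"] by (simp add: divide_right_mono add.assoc)
    qed
  qed auto
  from this[of v] this[of "- v"] show ?thesis by simp
qed

lemma directional_entropy_scale:
  "directional_entropy X (c *\<^sub>R v) = \<bar>c\<bar> * directional_entropy X v"
proof -
  consider "c > 0" | "c = 0" | "- c > 0" by linarith
  then show ?thesis
  proof cases
    case 3
    have "directional_entropy X (c *\<^sub>R v) = directional_entropy X ((- c) *\<^sub>R v)"
      using directional_entropy_minus[of "c *\<^sub>R v"] by simp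
    then show ?thesis using directional_entropy_pos_scale[OF 3] 3 by simp
  qed (simp_all add: directional_entropy_zero directional_entropy_pos_scale)
qed

text \<open>The slack in the geometric estimates is harmless because of homogeneity.\<close>

lemma directional_entropy_le:
  assumes bound: "\<And>e. 0 < e \<Longrightarrow> e < 1 \<Longrightarrow> \<forall>\<^sub>F t in at_top.
      log_count (closed_segment 0 ((t * (1 - e)) *\<^sub>R d)) (M + 2) \<le> g t"
    and lim: "((\<lambda>t. g t / t) \<longlongrightarrow> K) at_top"
  shows "directional_entropy X d \<le> K"
proof (rule field_le_mult_one_interval)
  fix z :: real assume z: "0 < z" "z < 1"
  have "directional_entropy X (z *\<^sub>R d) \<le> K"
  proof (rule tendsto_le[OF _ lim directional_entropy_tendsto[OF order_refl]])
    have "\<forall>\<^sub>F t in at_top. log_count (closed_segment 0 ((t * z) *\<^sub>R d)) (M + 2) \<le> g t"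
      using bound[of "1 - z"] z by simp
    then show "\<forall>\<^sub>F t in at_top. log_count (closed_segment 0 (t *\<^sub>R z *\<^sub>R d)) (M + 2) / t \<le> g t / t"
      using eventually_gt_at_top[of 0]
    proof eventually_elim
      case (elim t)
      then show ?case by (simp add: divide_right_mono)
    qed
  qed simp
  then show "z * directional_entropy X d \<le> K"
    using z by (simp add: directional_entropy_scale)
qed

text \<open>The triangle with vertices \<open>0\<close>, \<open>v\<close>, \<open>v + w\<close> lies to the left of the path \<open>v\<close>, \<open>w\<close>; its third side
  is safe since \<open>v + w\<close> is in the cone. So the path determines the triangle.\<close>

lemma directional_entropy_subadditive_on_cone:
  assumes F: "F \<in> \<F>" and v: "v \<in> corner_cone F" and w: "w \<in> corner_cone F" and pos: "cross v w > 0"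
  shows "directional_entropy X (v + w) \<le> directional_entropy X v + directional_entropy X w"
proof (rule directional_entropy_le)
  let ?B = "closed_segment 0 v \<union> closed_segment v (v + w)"
  let ?g = "\<lambda>t. log_count (closed_segment 0 (t *\<^sub>R v)) (M + 2) + log_count (closed_segment 0 (t *\<^sub>R w)) (M + 3)"
  show "((\<lambda>t. ?g t / t) \<longlongrightarrow> directional_entropy X v + directional_entropy X w) at_top"
    unfolding add_divide_distrib by (intro tendsto_add directional_entropy_tendsto) auto
  fix e :: real assume e: "0 < e" "e < 1"
  have scaled: "(*\<^sub>R) t ` ?B = closed_segment 0 (t *\<^sub>R v) \<union> closed_segment (t *\<^sub>R v) (t *\<^sub>R v + t *\<^sub>R w)" for t
    using closed_segment_linear_image[of "(*\<^sub>R) t" 0 v] closed_segment_linear_image[of "(*\<^sub>R) t" v "v + w"]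
    by (simp add: linear_scaleR image_Un scaleR_add_right)
  have "closed_segment 0 (0 + (v + w)) \<subseteq> convex hull {0, v, v + w}"
    by (simp add: closed_segment_subset_convex_hull hull_inc)
  moreover have "closed_segment p q \<subseteq> ?B \<or> p - q \<in> corner_cone F"
    if "(p, q) \<in> {(0, v), (v, v + w), (v + w, 0)}" for p q
    using that corner_cone_add[OF v w] by auto
  moreover have "cross (v - 0) (v + w - 0) > 0" using pos by (simp add: cross_simps)
  moreover have "bounded ?B" "?B \<noteq> {}" by (auto simp: bounded_closed_segment)
  ultimately have "\<forall>\<^sub>F t in at_top.
      log_count (closed_segment 0 ((t * (1 - e)) *\<^sub>R (v + w))) (M + 2) \<le> log_count ((*\<^sub>R) t ` ?B) M"
    using segment_bound_from_triangle[OF corner[OF F] v corner_bound[OF F], where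
        a = 0 and b = v and c = "v + w" and B = ?B and p = 0 and d = "v + w" and e = e and r = "M + 2"] e
    by blast
  then show "\<forall>\<^sub>F t in at_top. log_count (closed_segment 0 ((t * (1 - e)) *\<^sub>R (v + w))) (M + 2) \<le> ?g t"
  proof eventually_elim
    case (elim t)
    have "log_count (closed_segment 0 (t *\<^sub>R w)) (M + 1) \<le> log_count (closed_segment 0 (t *\<^sub>R w)) (M + 3)"
      "log_count (closed_segment 0 (t *\<^sub>R v)) M \<le> log_count (closed_segment 0 (t *\<^sub>R v)) (M + 2)"
      by (auto intro!: log_count_mono simp: bounded_closed_segment)
    then show ?case
      using elim log_count_path[of "t *\<^sub>R v" "t *\<^sub>R w" M] unfolding scaled by linarith
  qed
qed

text \<open>On each cone and on each negative of a cone the inequality is a matter of filling a triangle; these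
  open cones cover the punctured plane, so local convexity does the rest.\<close>

lemma directional_entropy_triangle_inequality:
  "directional_entropy X (v + w) \<le> directional_entropy X v + directional_entropy X w"
proof (rule subadditive_if_locally_convex)
  let ?h = "directional_entropy X"
  show "?h v \<ge> 0" for v by (rule directional_entropy_nonneg)
  show "?h (c *\<^sub>R v) = \<bar>c\<bar> * ?h v" for c v by (rule directional_entropy_scale)
  have on_cone: "?h (x + y) \<le> ?h x + ?h y"
    if F: "F \<in> \<F>" and x: "x \<in> corner_cone F" and y: "y \<in> corner_cone F" for F x y
  proof -
    consider "cross x y > 0" | "cross y x > 0" | "cross x y = 0" using cross_swap[of y x] by linarith
    then show ?thesis
    proof cases
      case 1
      then show ?thesis using directional_entropy_subadditive_on_cone[OF F x y] by simp
    next
      case 2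
      then show ?thesis using directional_entropy_subadditive_on_cone[OF F y x] by (simp add: add.commute)
    next
      case 3
      with directional_entropy_nonneg directional_entropy_scale show ?thesis
        by (rule subadditive_on_parallel_vectors)
    qed
  qed
  have combination: "?h (a *\<^sub>R x + b *\<^sub>R y) \<le> a * ?h x + b * ?h y"
    if "F \<in> \<F>" "x \<in> corner_cone F" "y \<in> corner_cone F" "a > 0" "b > 0" for F x y a b
    using on_cone[OF that(1) corner_cone_scale[OF that(2,4)] corner_cone_scale[OF that(3,5)]] that
    by (simp add: directional_entropy_scale)
  fix v :: "real \<times> real" assume "v \<noteq> 0"
  then obtain F where F: "F \<in> \<F>" "v \<in> corner_cone F \<or> - v \<in> corner_cone F"
    using cones_cover by blast
  show "\<exists>C. open C \<and> v \<in> C \<and> (\<forall>x\<in>C. \<forall>y\<in>C. \<forall>a>0. \<forall>b>0.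
      ?h (a *\<^sub>R x + b *\<^sub>R y) \<le> a * ?h x + b * ?h y)"
  proof (cases "v \<in> corner_cone F")
    case True
    then show ?thesis
      using combination[OF F(1)] open_corner_cone[OF finite_corner[OF F(1)]] by blast
  next
    case False
    let ?C = "uminus ` corner_cone F"
    have "open ?C" using open_negations open_corner_cone[OF finite_corner[OF F(1)]] by blast
    moreover have "v \<in> ?C" using F False by force
    moreover have "?h (a *\<^sub>R x + b *\<^sub>R y) \<le> a * ?h x + b * ?h y"
      if xy: "x \<in> ?C" "y \<in> ?C" and ab: "a > 0" "b > 0" for x y a b
    proof -
      obtain x' y' where xy': "x' \<in> corner_cone F" "y' \<in> corner_cone F" "x = - x'" "y = - y'"
        using xy by blast
      have "?h (a *\<^sub>R x + b *\<^sub>R y) = ?h (- (a *\<^sub>R x' + b *\<^sub>R y'))" by (simp add: xy' algebra_simps)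
      then show ?thesis
        using combination[OF F(1) xy'(1,2) ab] by (simp only: xy'(3,4) directional_entropy_minus)
    qed
    ultimately show ?thesis by (intro exI[of _ ?C] conjI ballI allI impI)
  qed
qed

text \<open>If the entropy vanishes in one direction, the thin triangle over it produces a second, independent
  direction of zero entropy, and a seminorm on the plane that vanishes on a basis is zero.\<close>

lemma directional_entropy_trivial_if_degenerate:
  assumes "v \<noteq> 0" "directional_entropy X v = 0"
  shows "directional_entropy X w = 0"
proof -
  let ?h = "directional_entropy X"
  obtain F where F: "F \<in> \<F>" "v \<in> corner_cone F \<or> - v \<in> corner_cone F"
    using cones_cover[OF assms(1)] by blast
  define u where "u = (if v \<in> corner_cone F then v else - v)"
  have u: "u \<in> corner_cone F" "u \<noteq> 0" "?h u = 0"
    using F(2) assms directional_entropy_minus[of v] by (auto simp: u_def)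
  obtain d where d: "cross u d > 0"
    "\<And>r e. e \<in> {0<..<1} \<Longrightarrow> \<forall>\<^sub>F t in at_top.
      log_count (closed_segment 0 ((t * (1 - e)) *\<^sub>R d)) r \<le> log_count (closed_segment 0 (t *\<^sub>R u)) M"
    using thin_triangle_bounds[OF F(1) u(1,2)] by blast
  have "?h d \<le> ?h u"
  proof (rule directional_entropy_le)
    show "((\<lambda>t. log_count (closed_segment 0 (t *\<^sub>R u)) (M + 2) / t) \<longlongrightarrow> ?h u) at_top"
      by (rule directional_entropy_tendsto) simp
    fix e :: real assume e: "0 < e" "e < 1"
    have "log_count (closed_segment 0 (t *\<^sub>R u)) M \<le> log_count (closed_segment 0 (t *\<^sub>R u)) (M + 2)" for t
      by (intro log_count_mono) (auto simp: bounded_closed_segment)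
    then show "\<forall>\<^sub>F t in at_top. log_count (closed_segment 0 ((t * (1 - e)) *\<^sub>R d)) (M + 2)
        \<le> log_count (closed_segment 0 (t *\<^sub>R u)) (M + 2)"
      using d(2)[of e "M + 2"] e by (auto elim!: eventually_mono intro: order_trans)
  qed
  then have "?h d = 0" using u(3) directional_entropy_nonneg[of d] by simp
  have "cross u d * ?h w = ?h (cross u d *\<^sub>R w)"
    using d(1) by (simp add: directional_entropy_scale)
  also have "\<dots> = ?h (cross w d *\<^sub>R u + cross u w *\<^sub>R d)"
    by (subst linear_combination_cross) (rule refl)
  also have "\<dots> \<le> \<bar>cross w d\<bar> * ?h u + \<bar>cross u w\<bar> * ?h d"
    using directional_entropy_triangle_inequality[of "cross w d *\<^sub>R u" "cross u w *\<^sub>R d"]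
    by (simp add: directional_entropy_scale)
  also have "\<dots> = 0" using u(3) \<open>?h d = 0\<close> by simp
  finally show ?thesis
    using d(1) directional_entropy_nonneg[of w] by (simp add: mult_le_0_iff)
qed

lemma directional_entropy_trivial_or_norm:
  "(\<forall>v. directional_entropy X v = 0) \<or> is_norm (directional_entropy X)"
proof (cases "\<exists>v. v \<noteq> 0 \<and> directional_entropy X v = 0")
  case True
  then obtain v where "v \<noteq> 0" "directional_entropy X v = 0" by blast
  then show ?thesis using directional_entropy_trivial_if_degenerate[of v] by simp
next
  case False
  then have "directional_entropy X v \<noteq> 0" if "v \<noteq> 0" for v using that by blast
  then have "directional_entropy X v = 0 \<longleftrightarrow> v = 0" for v
    using directional_entropy_zero by (cases "v = 0") simp_all
  then have "is_norm (directional_entropy X)"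
    unfolding is_norm_def
    by (simp add: directional_entropy_nonneg directional_entropy_scale
        directional_entropy_triangle_inequality del: split_paired_All)
  then show ?thesis ..
qed

end

section \<open>Corners of a polygon without antiparallel sides\<close>

lemma cross_eq_inner: "cross v z = (- snd v, fst v) \<bullet> z"
  by (simp add: cross_def inner_prod_def)

text \<open>A compact convex set on a line parallel to \<open>v\<close> is the segment between its extremes for the inner
  product with \<open>v\<close>.\<close>

lemma cross_maximizers_segment:
  assumes "compact K" "convex K" "K \<noteq> {}" "v \<noteq> 0" and level: "\<And>z. z \<in> K \<Longrightarrow> cross v z = m"
  obtains p q c where "K = closed_segment p q" "c \<ge> 0" "q - p = c *\<^sub>R v"
proof -
  obtain p where p: "p \<in> K" "\<And>z. z \<in> K \<Longrightarrow> v \<bullet> p \<le> v \<bullet> z"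
    using continuous_attains_inf[OF assms(1,3), of "\<lambda>z. v \<bullet> z"] by (force intro: continuous_intros)
  obtain q where q: "q \<in> K" "\<And>z. z \<in> K \<Longrightarrow> v \<bullet> z \<le> v \<bullet> q"
    using continuous_attains_sup[OF assms(1,3), of "\<lambda>z. v \<bullet> z"] by (force intro: continuous_intros)
  have vv: "v \<bullet> v > 0" using assms(4) by simp
  have line: "\<exists>c. z - p = c *\<^sub>R v" if "z \<in> K" for z
    using parallel_if_cross_zero[of v "z - p"] level[OF that] level[OF p(1)] assms(4)
    by (metis cross_simps(6) diff_self)
  obtain c where c: "q - p = c *\<^sub>R v" using line[OF q(1)] by blast
  have "v \<bullet> (q - p) \<ge> 0" using p(2)[OF q(1)] by (simp add: inner_diff_right)
  then have c0: "c \<ge> 0" using vv unfolding c by (simp add: zero_le_mult_iff)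
  have "K = closed_segment p q"
  proof
    show "closed_segment p q \<subseteq> K" using p q assms(2) by (simp add: closed_segment_subset)
    show "K \<subseteq> closed_segment p q"
    proof
      fix z assume z: "z \<in> K"
      then obtain b where b: "z - p = b *\<^sub>R v" using line by blast
      have "v \<bullet> (z - p) \<ge> 0" "v \<bullet> (q - p) \<ge> v \<bullet> (z - p)"
        using p(2)[OF z] q(2)[OF z] by (simp_all add: inner_diff_right)
      then have b0: "0 \<le> b" "b \<le> c" using vv unfolding b c by (simp_all add: zero_le_mult_iff)
      show "z \<in> closed_segment p q"
      proof (cases "c = 0")
        case True
        then show ?thesis using b b0 by simp
      next
        case False
        have "z = p + b *\<^sub>R v" using b by (metis add_diff_cancel_left' diff_add_cancel add.commute)
        also have "b *\<^sub>R v = (b / c) *\<^sub>R (q - p)" using False by (simp add: c)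
        also have "p + (b / c) *\<^sub>R (q - p) = (1 - b / c) *\<^sub>R p + (b / c) *\<^sub>R q"
          by (simp add: algebra_simps)
        finally show ?thesis
          unfolding closed_segment_def using b0 False by (auto intro!: exI[of _ "b / c"])
      qed
    qed
  qed
  then show thesis using that c0 c by blast
qed

text \<open>The points of \<open>P\<close> furthest to the left of \<open>v\<close> form a face. If the face is not a vertex, it is a side
  whose counterclockwise direction is opposite to \<open>v\<close>, since \<open>P\<close> lies to its left.\<close>

lemma supporting_vertex_or_side:
  assumes P: "compact P" "convex P" "P \<noteq> {}" and v: "v \<noteq> 0"
  shows "(\<exists>p. p extreme_point_of P \<and> (\<forall>z\<in>P - {p}. cross v (z - p) < 0)) \<or>
    (\<exists>p q c. oriented_side P p q \<and> c < 0 \<and> q - p = c *\<^sub>R v)"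
proof -
  obtain w where w: "w \<in> P" "\<And>z. z \<in> P \<Longrightarrow> cross v z \<le> cross v w"
    using continuous_attains_sup[OF P(1,3), of "cross v"]
    by (force simp: cross_eq_inner intro: continuous_intros)
  define K where "K = P \<inter> {z. (- snd v, fst v) \<bullet> z = cross v w}"
  have face: "K face_of P"
    unfolding K_def using w by (intro face_of_Int_supporting_hyperplane_le P(2)) (simp add: cross_eq_inner)
  have K: "compact K" "convex K" "K \<noteq> {}"
    using P(1) face_of_imp_compact[OF P(2,1) face] face_of_imp_convex[OF face] w
    by (auto simp: K_def cross_eq_inner)
  have mem: "z \<in> K \<longleftrightarrow> z \<in> P \<and> cross v z = cross v w" for z by (simp add: K_def cross_eq_inner)
  obtain q p c where pq: "K = closed_segment q p" "c \<ge> 0" "p - q = c *\<^sub>R v"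
    using cross_maximizers_segment[OF K v, of "cross v w"] mem by blast
  have p: "cross v p = cross v w" using mem[of p] pq(1) by simp
  show ?thesis
  proof (cases "p = q")
    case True
    then have Kp: "K = {p}" using pq(1) by simp
    then have "p extreme_point_of P" using face face_of_singleton by blast
    moreover have "cross v (z - p) < 0" if "z \<in> P - {p}" for z
      using that w(2)[of z] mem[of z] Kp p by (auto simp: cross_simps less_le)
    ultimately show ?thesis by blast
  next
    case False
    then have "c \<noteq> 0" using pq(3) by auto
    have "closed_segment p q edge_of P"
      using face False pq(1) by (simp add: edge_of_def closed_segment_commute segment_convex_hull aff_dim_convex_hull aff_dim_2)
    moreover have qp: "q - p = (- c) *\<^sub>R v" using pq(3) by (metis minus_diff_eq scaleR_minus_left)
    moreover have "cross (q - p) (z - p) \<ge> 0" if "z \<in> P" for z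
    proof -
      have "cross (q - p) (z - p) = c * (cross v w - cross v z)"
        unfolding qp using p by (simp add: cross_simps algebra_simps)
      then show ?thesis using w(2)[OF that] pq(2) by simp
    qed
    ultimately have "oriented_side P p q" by (simp add: oriented_side_def)
    moreover have "- c < 0" using pq(2) \<open>c \<noteq> 0\<close> by simp
    ultimately show ?thesis using qp by blast
  qed
qed

text \<open>If both the leftmost and the rightmost face in direction \<open>v\<close> were sides, they would be antiparallel.\<close>

lemma supporting_vertex_if_no_antiparallel_sides:
  assumes P: "compact P" "convex P" "P \<noteq> {}" and no: "\<not> has_antiparallel_sides P" and v: "v \<noteq> 0"
  shows "\<exists>p. p extreme_point_of P \<and>
    ((\<forall>z\<in>P - {p}. cross v (z - p) < 0) \<or> (\<forall>z\<in>P - {p}. cross (- v) (z - p) < 0))"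
proof (rule ccontr)
  assume none: "\<not> ?thesis"
  obtain p q c where pq: "oriented_side P p q" "c < 0" "q - p = c *\<^sub>R v"
    using supporting_vertex_or_side[OF P v] none by blast
  have "- v \<noteq> 0" using v by simp
  then obtain p' q' c' where pq': "oriented_side P p' q'" "c' < 0" "q' - p' = c' *\<^sub>R (- v)"
    using supporting_vertex_or_side[OF P, of "- v"] none by blast
  have "q' - p' = (- c' / c) *\<^sub>R (q - p)" using pq pq' by simp
  moreover have "- c' / c < 0" using pq(2) pq'(2) by (simp add: zero_less_divide_iff)
  ultimately have "has_antiparallel_sides P"
    unfolding has_antiparallel_sides_def using pq(1) pq'(1) by blast
  with no show False by contradiction
qed

definition lattice_corner :: "(real \<times> real) set \<Rightarrow> real \<times> real \<Rightarrow> (int \<times> int) set" where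
  "lattice_corner P p = {f. f \<noteq> 0 \<and> p + lattice_pt f \<in> P}"

lemma (in nonempty_Z2_shift) corner_rule_lattice_corner:
  assumes codes: "codes X (P - {lattice_pt u}) {lattice_pt u}"
  shows "corner_rule X (lattice_corner P (lattice_pt u))"
  unfolding corner_rule_def
proof (intro ballI allI impI)
  fix x x' w
  assume x: "x \<in> X" "x' \<in> X"
    and agree: "\<forall>f\<in>lattice_corner P (lattice_pt u). x (w + f) = x' (w + f)"
  have "agree_on (P - {lattice_pt u}) (translate (w - u) x) (translate (w - u) x')"
    unfolding agree_on_def
  proof (intro allI impI)
    fix s assume s: "lattice_pt s \<in> P - {lattice_pt u}"
    then have "s - u \<in> lattice_corner P (lattice_pt u)"
      by (auto simp: lattice_corner_def lattice_pt_diff)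
    with agree have "x (w + (s - u)) = x' (w + (s - u))" by blast
    then show "translate (w - u) x s = translate (w - u) x' s"
      by (simp add: translate_def algebra_simps)
  qed
  then have "agree_on {lattice_pt u} (translate (w - u) x) (translate (w - u) x')"
    using codes x translate_mem unfolding codes_def by blast
  then have "translate (w - u) x u = translate (w - u) x' u"
    unfolding agree_on_def by blast
  then show "x w = x' w" by (simp add: translate_def)
qed

theorem corollary6p6:
  fixes A :: "'a set" and X :: "'a config set" and P :: "(real \<times> real) set"
  assumes "polygonal A X"
    and "coding_polygon X P"
    and "\<not> has_antiparallel_sides P"
  shows "(\<forall>v. entropy_seminorm X v = 0) \<or> is_norm (entropy_seminorm X)"
proof -
  have shift: "Z2_shift A X" and X: "infinite X"
    using assms(1) by (auto simp: polygonal_def)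
  interpret nonempty_Z2_shift A X
    by unfold_locales (use shift X in auto)
  have P: "polytope P" "P \<noteq> {}" and vertices: "\<And>p. p extreme_point_of P \<Longrightarrow> p \<in> range lattice_pt"
    and codes: "\<And>p. p extreme_point_of P \<Longrightarrow> codes X (P - {p}) {p}"
    using assms(2) by (auto simp: coding_polygon_def convex_integer_polygon_def)
  have cP: "compact P" "convex P" "bounded P"
    using P(1) by (auto simp: polytope_imp_compact polytope_imp_convex polytope_imp_bounded)
  let ?\<F> = "lattice_corner P ` {p. p extreme_point_of P}"
  have "corner_coded_shift A X ?\<F> (diameter P + 1)"
  proof unfold_locales
    fix F assume "F \<in> ?\<F>"
    then obtain p u where p: "F = lattice_corner P p" "p extreme_point_of P" "p = lattice_pt u"
      using vertices by blast
    have pP: "p \<in> P" using p(2) by (simp add: extreme_point_of_def)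
    show "corner_rule X F"
      using corner_rule_lattice_corner[of P u] codes[OF p(2)] p(1,3) by simp
    have "F \<subseteq> {f. lattice_pt f \<in> (+) (- p) ` P}"
    proof
      fix f assume "f \<in> F"
      then have "p + lattice_pt f \<in> P" by (simp add: p(1) lattice_corner_def)
      then have "- p + (p + lattice_pt f) \<in> (+) (- p) ` P" by (rule imageI)
      then show "f \<in> {f. lattice_pt f \<in> (+) (- p) ` P}" by simp
    qed
    then show "finite F"
      by (rule finite_subset) (intro finite_lattice_points bounded_translation cP)
    fix f assume "f \<in> F"
    then have "p + lattice_pt f \<in> P" by (simp add: p(1) lattice_corner_def)
    from diameter_bounded_bound[OF cP(3) this pP]
    show "norm (lattice_pt f) < diameter P + 1" by (simp add: dist_norm)
  next
    fix v :: "real \<times> real" assume "v \<noteq> 0"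
    then obtain p where p: "p extreme_point_of P"
      "(\<forall>z\<in>P - {p}. cross v (z - p) < 0) \<or> (\<forall>z\<in>P - {p}. cross (- v) (z - p) < 0)"
      using supporting_vertex_if_no_antiparallel_sides[OF cP(1,2) P(2) assms(3)] by blast
    have "w \<in> corner_cone (lattice_corner P p)" if w: "\<forall>z\<in>P - {p}. cross w (z - p) < 0" for w
      unfolding corner_cone_def
    proof (intro CollectI ballI)
      fix f assume f: "f \<in> lattice_corner P p"
      have "lattice_pt f \<noteq> lattice_pt 0"
        using f by (auto simp: lattice_corner_def dest: injD[OF inj_lattice_pt])
      then have "p + lattice_pt f \<in> P - {p}"
        using f by (auto simp: lattice_corner_def lattice_pt_def zero_prod_def)
      with w have "cross w (p + lattice_pt f - p) < 0" by blast
      then show "cross w (lattice_pt f) < 0" by simp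
    qed
    with p show "\<exists>F\<in>?\<F>. v \<in> corner_cone F \<or> - v \<in> corner_cone F" by blast
  qed
  then show ?thesis by (rule corner_coded_shift.directional_entropy_trivial_or_norm)
qed

end
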